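(* Let $G$ be a locally compact separable unimodular group. Let $1<q\le\infty$ and $1<p\le\min(2,q)$. Let $f\in L^1(G)$ be such that $\tau(P_{\mathrm{supp}^R[\widehat f]})<\infty$, where $P_{\mathrm{supp}^R[\widehat f]}$ denotes the orthogonal projector onto $\mathrm{supp}^R[\widehat f]$. Then $$\|f\|_{L^q(G)}\lesssim\left(\tau(P_{\mathrm{supp}^R[\widehat f]})\right)^{\frac1p-\frac1q}\|f\|_{L^p(G)},$$ with the implied constant independent of $f$.
   Context: $G$ carries a fixed Haar measure. On $L^2(G)$ let $\pi_R(g)f(x)=f(xg)$. $VN_R(G)$ is the von Neumann algebra on $L^2(G)$ generated by $\{\pi_R(g)\}_{g\in G}$. $\tau$ is the canonical trace on $VN_R(G)$: for a positive $A\in VN_R(G)$ acting as $h\mapsto h*K_A$, $\tau(A)=\|K_{A^{1/2}}\|_{L^2(G)}^2$ if $K_{A^{1/2}}\in L^2(G)$ and $\tau(A)=\infty$ otherwise. For $f\in L^1(G)$, the right Fourier transform of $f$ is the operator $\mathcal F^R[f]=R_f: L^2(G)\ni h\mapsto h*f\in L^2(G)$. Its support is the subspace $\mathrm{supp}^R[\widehat f]:=\mathrm{Ker}(\mathcal F^R[f])^{\perp}\subset L^2(G)$. *)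

theory Defs
  imports "HOL-Analysis.Analysis" "HOL-Probability.Essential_Supremum"
begin

text \<open>
  Groups are types of class \<open>topological_group_add\<close>. This class is not commutative; the group
  law is merely written additively, so \<open>x + g\<close> stands for $xg$, \<open>- y + x\<close> for $y^{-1}x$
  and \<open>0\<close> for the identity. Locally compact groups are Hausdorff by convention.
\<close>

text \<open>Left Haar measures as Radon measures on the Borel sets.\<close>

definition haar_measure :: "'a::{topological_group_add,t2_space} measure \<Rightarrow> bool" where
  "haar_measure \<mu> \<longleftrightarrow>
     sets \<mu> = sets borel \<and>
     (\<forall>K. compact K \<longrightarrow> emeasure \<mu> K < \<infinity>) \<and>
     (\<forall>E\<in>sets borel. emeasure \<mu> E = (INF U\<in>{U. open U \<and> E \<subseteq> U}. emeasure \<mu> U)) \<and>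
     (\<forall>U. open U \<longrightarrow> emeasure \<mu> U = (SUP K\<in>{K. compact K \<and> K \<subseteq> U}. emeasure \<mu> K)) \<and>
     emeasure \<mu> UNIV \<noteq> 0 \<and>
     (\<forall>g. \<forall>E\<in>sets borel. emeasure \<mu> ((\<lambda>x. g + x) ` E) = emeasure \<mu> E)"

text \<open>
  The group is unimodular iff its left Haar measure (unique up to a positive factor) is also
  right invariant.
\<close>

definition unimodular :: "'a::{topological_group_add,t2_space} measure \<Rightarrow> bool" where
  "unimodular \<mu> \<longleftrightarrow> haar_measure \<mu> \<and>
     (\<forall>g. \<forall>E\<in>sets borel. emeasure \<mu> ((\<lambda>x. x + g) ` E) = emeasure \<mu> E)"

text \<open>Powers with exponent \<open>r \<ge> 0\<close>, including \<open>0\<^sup>0 = 1\<close> (unlike \<open>powr\<close>).\<close>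

definition epowr :: "ennreal \<Rightarrow> real \<Rightarrow> ennreal" where
  "epowr x r = (if r = 0 then 1 else if x = \<infinity> then \<infinity> else ennreal (enn2real x powr r))"

definition lp_norm :: "ennreal \<Rightarrow> 'a measure \<Rightarrow> ('a \<Rightarrow> complex) \<Rightarrow> ennreal" where
  "lp_norm p \<mu> f =
     (if p = \<infinity> then esssup \<mu> (\<lambda>x. ennreal (norm (f x)))
      else epowr (\<integral>\<^sup>+ x. ennreal (norm (f x) powr enn2real p) \<partial>\<mu>) (1 / enn2real p))"

text \<open>
  An element of $L^2(G)$ is represented by any square integrable function in its class, and an
  operator on $L^2(G)$ by a map on functions that respects equality almost everywhere on
  square integrable functions; its values elsewhere are irrelevant. Equality of operators
  is \<open>op_eq\<close>.
\<close>

definition L2 :: "'a measure \<Rightarrow> ('a \<Rightarrow> complex) set" where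
  "L2 \<mu> = {h \<in> borel_measurable \<mu>. lp_norm 2 \<mu> h < \<infinity>}"

definition l2_inner :: "'a measure \<Rightarrow> ('a \<Rightarrow> complex) \<Rightarrow> ('a \<Rightarrow> complex) \<Rightarrow> complex" where
  "l2_inner \<mu> h k = (LINT x|\<mu>. h x * cnj (k x))"

type_synonym 'a l2_op = "('a \<Rightarrow> complex) \<Rightarrow> ('a \<Rightarrow> complex)"

definition op_eq :: "'a measure \<Rightarrow> 'a l2_op \<Rightarrow> 'a l2_op \<Rightarrow> bool" where
  "op_eq \<mu> A B \<longleftrightarrow> (\<forall>h\<in>L2 \<mu>. AE x in \<mu>. A h x = B h x)"

text \<open>Compatibility with equality almost everywhere follows from linearity and boundedness.\<close>

definition bounded_op :: "'a measure \<Rightarrow> 'a l2_op \<Rightarrow> bool" where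
  "bounded_op \<mu> A \<longleftrightarrow>
     (\<forall>h\<in>L2 \<mu>. A h \<in> L2 \<mu>) \<and>
     (\<forall>h\<in>L2 \<mu>. \<forall>k\<in>L2 \<mu>. AE x in \<mu>. A (\<lambda>y. h y + k y) x = A h x + A k x) \<and>
     (\<forall>c. \<forall>h\<in>L2 \<mu>. AE x in \<mu>. A (\<lambda>y. c * h y) x = c * A h x) \<and>
     (\<exists>C::real. \<forall>h\<in>L2 \<mu>. lp_norm 2 \<mu> (A h) \<le> ennreal C * lp_norm 2 \<mu> h)"

definition is_adjoint :: "'a measure \<Rightarrow> 'a l2_op \<Rightarrow> 'a l2_op \<Rightarrow> bool" where
  "is_adjoint \<mu> A B \<longleftrightarrow> bounded_op \<mu> A \<and> bounded_op \<mu> B \<and>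
     (\<forall>h\<in>L2 \<mu>. \<forall>k\<in>L2 \<mu>. l2_inner \<mu> (A h) k = l2_inner \<mu> h (B k))"

definition commutant :: "'a measure \<Rightarrow> 'a l2_op set \<Rightarrow> 'a l2_op set" where
  "commutant \<mu> S = {A. bounded_op \<mu> A \<and> (\<forall>B\<in>S. op_eq \<mu> (A \<circ> B) (B \<circ> A))}"

text \<open>
  A selfadjoint set of operators that equals its bicommutant; being a unital subalgebra of the
  bounded operators is automatic for a commutant.
\<close>

definition von_neumann_algebra :: "'a measure \<Rightarrow> 'a l2_op set \<Rightarrow> bool" where
  "von_neumann_algebra \<mu> M \<longleftrightarrow>
     (\<forall>A\<in>M. \<forall>B. is_adjoint \<mu> A B \<longrightarrow> B \<in> M) \<and> commutant \<mu> (commutant \<mu> M) = M"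

definition right_regular :: "'a::topological_group_add \<Rightarrow> 'a l2_op" where
  "right_regular g h = (\<lambda>x. h (x + g))"

definition VN_R :: "'a::topological_group_add measure \<Rightarrow> 'a l2_op set" where
  "VN_R \<mu> = \<Inter>{M. von_neumann_algebra \<mu> M \<and> range right_regular \<subseteq> M}"

definition convolution ::
  "'a::topological_group_add measure \<Rightarrow> ('a \<Rightarrow> complex) \<Rightarrow> ('a \<Rightarrow> complex) \<Rightarrow> 'a \<Rightarrow> complex" where
  "convolution \<mu> h f = (\<lambda>x. LINT y|\<mu>. h y * f (- y + x))"

definition positive_op :: "'a measure \<Rightarrow> 'a l2_op \<Rightarrow> bool" where
  "positive_op \<mu> A \<longleftrightarrow> bounded_op \<mu> A \<and> (\<forall>h\<in>L2 \<mu>. l2_inner \<mu> (A h) h \<in> \<real>\<^sub>\<ge>\<^sub>0)"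

definition is_sqrt_op :: "'a measure \<Rightarrow> 'a l2_op \<Rightarrow> 'a l2_op \<Rightarrow> bool" where
  "is_sqrt_op \<mu> A B \<longleftrightarrow> positive_op \<mu> B \<and> op_eq \<mu> (B \<circ> B) A"

text \<open>\<open>K\<close> is a square integrable kernel of the operator \<open>A\<close>; it is unique almost everywhere.\<close>

definition is_L2_kernel ::
  "'a::topological_group_add measure \<Rightarrow> 'a l2_op \<Rightarrow> ('a \<Rightarrow> complex) \<Rightarrow> bool" where
  "is_L2_kernel \<mu> A K \<longleftrightarrow> K \<in> L2 \<mu> \<and> op_eq \<mu> A (\<lambda>h. convolution \<mu> h K)"

text \<open>
  The canonical trace is only meaningful on the positive elements of \<open>VN_R\<close>; elsewhere it gets
  the value \<open>\<infinity>\<close>.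
\<close>

definition vn_trace :: "'a::topological_group_add measure \<Rightarrow> 'a l2_op \<Rightarrow> ennreal" where
  "vn_trace \<mu> A =
     (if A \<in> VN_R \<mu> \<and> positive_op \<mu> A \<and> (\<exists>B K. is_sqrt_op \<mu> A B \<and> is_L2_kernel \<mu> B K)
      then (lp_norm 2 \<mu> (SOME K. \<exists>B. is_sqrt_op \<mu> A B \<and> is_L2_kernel \<mu> B K))\<^sup>2
      else \<infinity>)"

definition right_fourier ::
  "'a::topological_group_add measure \<Rightarrow> ('a \<Rightarrow> complex) \<Rightarrow> 'a l2_op" where
  "right_fourier \<mu> f = (\<lambda>h. convolution \<mu> h f)"

definition op_kernel :: "'a measure \<Rightarrow> 'a l2_op \<Rightarrow> ('a \<Rightarrow> complex) set" where
  "op_kernel \<mu> A = {h \<in> L2 \<mu>. AE x in \<mu>. A h x = 0}"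

definition ortho_complement ::
  "'a measure \<Rightarrow> ('a \<Rightarrow> complex) set \<Rightarrow> ('a \<Rightarrow> complex) set" where
  "ortho_complement \<mu> S = {h \<in> L2 \<mu>. \<forall>k\<in>S. l2_inner \<mu> h k = 0}"

definition supp_R ::
  "'a::topological_group_add measure \<Rightarrow> ('a \<Rightarrow> complex) \<Rightarrow> ('a \<Rightarrow> complex) set" where
  "supp_R \<mu> f = ortho_complement \<mu> (op_kernel \<mu> (right_fourier \<mu> f))"

text \<open>
  \<open>P\<close> represents the orthogonal projector onto the closed subspace \<open>S\<close>; it is determined up
  to \<open>op_eq\<close>.
\<close>

definition is_orth_projector ::
  "'a measure \<Rightarrow> ('a \<Rightarrow> complex) set \<Rightarrow> 'a l2_op \<Rightarrow> bool" where
  "is_orth_projector \<mu> S P \<longleftrightarrow>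
     (\<forall>h\<in>L2 \<mu>. P h \<in> S \<and> (\<forall>s\<in>S. l2_inner \<mu> (\<lambda>x. h x - P h x) s = 0))"

end

theory Submission
  imports Defs
begin

text \<open>
  The inequality holds with constant $1$. Write $\tau$ for the trace of the projector $P$ onto the
  support of $\widehat f$, and let $K$ be the square integrable kernel with
  $\tau = \|K\|_2^2$ that the finiteness of the trace provides.

  First, $R_f P = R_f$. The adjoint of $R_f$ is $R_{f^*}$ with $f^*(x) = \overline{f(x^{-1})}$, so
  the range of $R_{f^*}$ lies in the orthogonal complement of the kernel of $R_f$, and
  $h - Ph$ is orthogonal to it; hence $R_f (h - Ph) = 0$ (\<open>convolution_projector\<close>).
  Second, if $B$ is the square root of $P$ with kernel $K$, then
  $\|Ph\|^2 = \langle Ph, h \rangle = \langle B^2 h, h\rangle = \|Bh\|^2 = \|h * K\|^2$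
  (\<open>projector_norm_eq_sqrt_norm\<close>). So for every $h \in L^2$ with $\|h\|_1 = 1$ the function
  $u = Ph$ satisfies $h * f = u * f$ and $\|u\|_2^2 \le \|K\|_2^2 = \tau$.
  The three elementary cases of Young's inequality then bound $h * f$ in $L^2$ by
  $\tau^{1/2} \|f\|_1$ and uniformly by $\tau^{1/2} \|f\|_2$. Letting $h$ run through an
  approximate identity gives $f \in L^2$ and $\|f\|_\infty \le \tau^{1/2} \|f\|_2$
  (\<open>finite_trace_bounds\<close>).

  The rest is interpolation (\<open>lp_norm_interpolation\<close>). Since $p \le 2$,
  $\|f\|_\infty^2 \le \tau \|f\|_2^2 \le \tau \|f\|_\infty^{2 - p} \|f\|_p^p$, and
  as $\|f\|_\infty$ is already known to be finite this gives
  $\|f\|_\infty \le \tau^{1/p} \|f\|_p$. Finally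
  $\|f\|_q \le \|f\|_\infty^{1 - p/q} \|f\|_p^{p/q}$.

  The measure theory needs care because a separable group need not be second countable: the map
  $(y, x) \mapsto y^{-1} x$ need not be measurable from the product of the Borel algebras
  to the Borel algebra, so Tonelli's theorem does not apply to $h(y) f(y^{-1} x)$ as it
  stands. Regularity of the Haar measure and a countable dense set repair this: every measurable
  function agrees almost everywhere with one whose composition with the map is product
  measurable (\<open>diff_measurable_between\<close>, \<open>complex_AE_diff_measurable\<close>). Convolutions do not
  notice the change, because the Haar measure is invariant under $y \mapsto y^{-1} x$
  (\<open>distr_inv\<close>).
\<close>

section \<open>Neighbourhoods in topological groups\<close>

text \<open>
  The triple is tailored to \<open>diff_measurable_between\<close>: with $y = dv$ and
  $d^{-1} x = b c k$ one has $y^{-1} x = v^{-1} b c k$.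
\<close>

lemma open_triple_neighbourhood:
  fixes U :: "'a::topological_group_add set"
  assumes "open U" and "0 \<in> U"
  shows "\<exists>V. open V \<and> 0 \<in> V \<and> (\<forall>a\<in>V. \<forall>b\<in>V. \<forall>c\<in>V. - a + b + c \<in> U)"
proof -
  define g where "g = (\<lambda>z::'a \<times> 'a \<times> 'a. - fst z + fst (snd z) + snd (snd z))"
  have "continuous_on UNIV g"
    unfolding g_def by (intro continuous_intros)
  then have op: "open (g -` U)"
    using assms(1) by (rule open_vimage[rotated])
  have "(0, 0, 0) \<in> g -` U"
    using assms(2) by (simp add: g_def)
  then obtain A B where AB: "open A" "open B" "0 \<in> A" "(0, 0) \<in> B" "A \<times> B \<subseteq> g -` U"
    using open_prod_elim[OF op] by (metis mem_Sigma_iff)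
  obtain B1 B2 where B: "open B1" "open B2" "0 \<in> B1" "0 \<in> B2" "B1 \<times> B2 \<subseteq> B"
    using open_prod_elim[OF AB(2) AB(4)] by (metis mem_Sigma_iff)
  have "- a + b + c \<in> U" if "a \<in> A" "b \<in> B1" "c \<in> B2" for a b c
  proof -
    have "(a, b, c) \<in> g -` U"
      using that AB(5) B(5) by blast
    then show ?thesis by (simp add: g_def)
  qed
  then show ?thesis
    using AB B by (intro exI[of _ "A \<inter> B1 \<inter> B2"]) auto
qed

lemma compact_left_neighbourhood:
  fixes U :: "'a::topological_group_add set"
  assumes "compact C" "open U" "C \<subseteq> U"
  shows "\<exists>V. open V \<and> 0 \<in> V \<and> (\<forall>v\<in>V. \<forall>c\<in>C. v + c \<in> U)"
proof -
  define g where "g = (\<lambda>z::'a \<times> 'a. fst z + snd z)"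
  have "continuous_on UNIV g"
    unfolding g_def by (intro continuous_intros)
  then have op: "open (g -` U)"
    using assms(2) by (rule open_vimage[rotated])
  have "{0} \<times> C \<subseteq> g -` U"
    using assms(3) by (auto simp: g_def)
  from Elementary_Topology.tube_lemma[OF assms(1) op this]
  obtain V where V: "0 \<in> V" "open V" "V \<times> C \<subseteq> g -` U"
    by blast
  have "v + c \<in> U" if "v \<in> V" "c \<in> C" for v c
  proof -
    have "(v, c) \<in> g -` U" using V(3) that by blast
    then show ?thesis by (simp add: g_def)
  qed
  then show ?thesis using V(1,2) by blast
qed

section \<open>Haar measure on a separable unimodular group\<close>

locale separable_unimodular_group =
  fixes \<mu> :: "'a::{topological_group_add,t2_space} measure"
  assumes separable: "separable_space (euclidean :: 'a topology)"
    and unimodular: "unimodular \<mu>"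
begin

lemma haar: "haar_measure \<mu>"
  using unimodular by (simp add: unimodular_def)

lemma sets_mu [measurable_cong]: "sets \<mu> = sets borel"
  using haar by (simp add: haar_measure_def)

lemma space_mu [simp]: "space \<mu> = UNIV"
  using sets_eq_imp_space_eq[OF sets_mu] by simp

lemma open_sets [measurable]: "open U \<Longrightarrow> U \<in> sets \<mu>"
  by (simp add: sets_mu)

lemma compact_sets [measurable]: "compact C \<Longrightarrow> C \<in> sets \<mu>"
  by (simp add: sets_mu borel_closed compact_imp_closed)

lemma compact_finite: "compact C \<Longrightarrow> emeasure \<mu> C < \<infinity>"
  by (rule haar[unfolded haar_measure_def, THEN conjunct2, THEN conjunct1, rule_format])

lemma outer_regular: "E \<in> sets \<mu> \<Longrightarrow> emeasure \<mu> E = (INF U\<in>{U. open U \<and> E \<subseteq> U}. emeasure \<mu> U)"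
  unfolding sets_mu
  by (rule haar[unfolded haar_measure_def, THEN conjunct2, THEN conjunct2, THEN conjunct1, THEN bspec])

lemma inner_regular: "open U \<Longrightarrow> emeasure \<mu> U = (SUP K\<in>{K. compact K \<and> K \<subseteq> U}. emeasure \<mu> K)"
  by (rule haar[unfolded haar_measure_def, THEN conjunct2, THEN conjunct2, THEN conjunct2,
        THEN conjunct1, THEN spec, THEN mp])

lemma positive: "emeasure \<mu> UNIV \<noteq> 0"
  by (rule haar[unfolded haar_measure_def, THEN conjunct2, THEN conjunct2, THEN conjunct2,
        THEN conjunct2, THEN conjunct1])

lemma left_invariant: "E \<in> sets \<mu> \<Longrightarrow> emeasure \<mu> ((\<lambda>x. g + x) ` E) = emeasure \<mu> E"
  unfolding sets_mu
  by (rule haar[unfolded haar_measure_def, THEN conjunct2, THEN conjunct2, THEN conjunct2,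
        THEN conjunct2, THEN conjunct2, THEN spec, THEN bspec])

lemma right_invariant: "E \<in> sets \<mu> \<Longrightarrow> emeasure \<mu> ((\<lambda>x. x + g) ` E) = emeasure \<mu> E"
  unfolding sets_mu
  by (rule unimodular[unfolded unimodular_def, THEN conjunct2, THEN spec, THEN bspec])

lemma outer_open:
  assumes "E \<in> sets \<mu>" and "emeasure \<mu> E < r"
  shows "\<exists>U. open U \<and> E \<subseteq> U \<and> emeasure \<mu> U < r"
proof -
  have "(INF U\<in>{U. open U \<and> E \<subseteq> U}. emeasure \<mu> U) < r"
    using assms outer_regular by simp
  then show ?thesis by (auto simp: Inf_less_iff)
qed

lemma inner_compact:
  assumes "open U" and "r < emeasure \<mu> U"
  shows "\<exists>C. compact C \<and> C \<subseteq> U \<and> r < emeasure \<mu> C"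
proof -
  have "r < (SUP K\<in>{K. compact K \<and> K \<subseteq> U}. emeasure \<mu> K)"
    using assms inner_regular by simp
  then show ?thesis by (auto simp: less_Sup_iff)
qed

lemma cont_ltrans: "continuous_on UNIV (\<lambda>x::'a. g + x)"
  and cont_rtrans: "continuous_on UNIV (\<lambda>x::'a. x + g)"
  and cont_inv: "continuous_on UNIV (\<lambda>x::'a. - x)"
  and cont_sub: "continuous_on UNIV (\<lambda>x::'a. x - g)"
  and cont_inv_trans: "continuous_on UNIV (\<lambda>x::'a. - x + g)"
  by (intro continuous_intros)+

lemma measurable_trans [measurable]:
  "(\<lambda>x. g + x) \<in> \<mu> \<rightarrow>\<^sub>M \<mu>" "(\<lambda>x. x + g) \<in> \<mu> \<rightarrow>\<^sub>M \<mu>" "(\<lambda>x. - x) \<in> \<mu> \<rightarrow>\<^sub>M \<mu>"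
  "(\<lambda>x. - x + g) \<in> \<mu> \<rightarrow>\<^sub>M \<mu>"
  using cont_ltrans cont_rtrans cont_inv cont_inv_trans
  by (auto simp: measurable_cong_sets[OF sets_mu sets_mu] intro!: borel_measurable_continuous_onI)

lemma distr_ltrans: "distr \<mu> \<mu> (\<lambda>x. g + x) = \<mu>"
proof (rule measure_eqI)
  fix E assume "E \<in> sets (distr \<mu> \<mu> (\<lambda>x. g + x))"
  then have E [measurable]: "E \<in> sets \<mu>" by simp
  have "(\<lambda>x. g + x) -` E = (\<lambda>x. - g + x) ` E"
    by (auto simp: image_iff add.assoc[symmetric] intro!: bexI[where x="g + _"])
  then have "emeasure \<mu> ((\<lambda>x. g + x) -` E) = emeasure \<mu> E"
    using E left_invariant by simp
  then show "emeasure (distr \<mu> \<mu> (\<lambda>x. g + x)) E = emeasure \<mu> E"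
    by (simp add: emeasure_distr)
qed simp

lemma distr_rtrans: "distr \<mu> \<mu> (\<lambda>x. x + g) = \<mu>"
proof (rule measure_eqI)
  fix E assume "E \<in> sets (distr \<mu> \<mu> (\<lambda>x. x + g))"
  then have E [measurable]: "E \<in> sets \<mu>" by simp
  have "(\<lambda>x. x + g) -` E = (\<lambda>x. x + - g) ` E"
    by (auto simp: image_iff add.assoc diff_conv_add_uminus simp del: add_uminus_conv_diff intro!: bexI[where x="_ + g"])
  then have "emeasure \<mu> ((\<lambda>x. x + g) -` E) = emeasure \<mu> E"
    using right_invariant[OF E, of "- g"] by simp
  then show "emeasure (distr \<mu> \<mu> (\<lambda>x. x + g)) E = emeasure \<mu> E"
    by (simp add: emeasure_distr)
qed simp

lemma nn_integral_ltrans: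
  assumes [measurable]: "w \<in> borel_measurable \<mu>"
  shows "(\<integral>\<^sup>+x. w (g + x) \<partial>\<mu>) = (\<integral>\<^sup>+x. w x \<partial>\<mu>)"
  using nn_integral_distr[of "\<lambda>x. g + x" \<mu> \<mu> w] by (simp add: distr_ltrans)

lemma nn_integral_rtrans:
  assumes [measurable]: "w \<in> borel_measurable \<mu>"
  shows "(\<integral>\<^sup>+x. w (x + g) \<partial>\<mu>) = (\<integral>\<^sup>+x. w x \<partial>\<mu>)"
  using nn_integral_distr[of "\<lambda>x. x + g" \<mu> \<mu> w] by (simp add: distr_rtrans)

text \<open>
  Translates of a neighbourhood of the identity by a countable dense set cover the group. This is
  the form in which separability is used throughout.
\<close>

lemma countable_cover:
  "\<exists>D::'a set. countable D \<and> (\<forall>V x. open V \<longrightarrow> 0 \<in> V \<longrightarrow> (\<exists>d\<in>D. - d + x \<in> V))"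
proof -
  obtain D :: "'a set" where D: "countable D" "euclidean closure_of D = UNIV"
    using separable by (auto simp: separable_space_def)
  have "\<exists>d\<in>D. - d + x \<in> V" if V: "open V" "0 \<in> V" for V and x :: 'a
  proof -
    have "open ((\<lambda>d. - d + x) -` V)"
      by (intro open_vimage V cont_inv_trans)
    moreover have "x \<in> (\<lambda>d. - d + x) -` V" using V by simp
    moreover have "x \<in> closure D" using D(2) by simp
    ultimately have "((\<lambda>d. - d + x) -` V) \<inter> D \<noteq> {}"
      using open_Int_closure_eq_empty[of "(\<lambda>d. - d + x) -` V" D] by (metis disjoint_iff)
    then show ?thesis by auto
  qed
  then show ?thesis using D(1) by blast
qed

lemma finite_neighbourhood:
  "\<exists>V :: 'a set. open V \<and> 0 \<in> V \<and> emeasure \<mu> V < \<infinity>"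
proof -
  have "emeasure \<mu> {0} < \<infinity>" by (rule compact_finite) simp
  then obtain V :: "'a set" where "open V" "{0} \<subseteq> V" "emeasure \<mu> V < \<infinity>"
    using outer_open[OF compact_sets[of "{0}"], of \<infinity>] by auto
  then show ?thesis by blast
qed

lemma emeasure_trans_vimage:
  "V \<in> sets \<mu> \<Longrightarrow> emeasure \<mu> ((\<lambda>x. g + x) -` V) = emeasure \<mu> V"
  using arg_cong[OF distr_ltrans[of g], of "\<lambda>M. emeasure M V"] by (simp add: emeasure_distr)

lemma sigma_finite: "sigma_finite_measure \<mu>"
proof -
  obtain D :: "'a set" where D: "countable D" "\<And>V x. open V \<Longrightarrow> 0 \<in> V \<Longrightarrow> \<exists>d\<in>D. - d + x \<in> V"
    using countable_cover by blast
  obtain V :: "'a set" where V: "open V" "0 \<in> V" "emeasure \<mu> V < \<infinity>"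
    using finite_neighbourhood by blast
  let ?A = "(\<lambda>d. (\<lambda>x. - d + x) -` V) ` D"
  have "?A \<subseteq> sets \<mu>"
    by (auto intro!: open_sets open_vimage V cont_ltrans)
  moreover have "\<Union>?A = UNIV"
    using D(2)[OF V(1,2)] by auto
  moreover have "\<forall>a\<in>?A. emeasure \<mu> a \<noteq> \<infinity>"
    using V by (auto simp: emeasure_trans_vimage)
  ultimately show ?thesis
    using D(1) by (intro sigma_finite_measure.intro exI[of _ ?A]) auto
qed

text \<open>
  If a neighbourhood of the identity were null, countably many null translates would cover the
  group.
\<close>

lemma open_pos:
  assumes "open V" "0 \<in> (V::'a set)"
  shows "emeasure \<mu> V > 0"
proof (rule ccontr)
  assume "\<not> emeasure \<mu> V > 0"
  then have V0: "emeasure \<mu> V = 0" by simp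
  obtain D :: "'a set" where D: "countable D" "\<And>V x. open V \<Longrightarrow> 0 \<in> V \<Longrightarrow> \<exists>d\<in>D. - d + x \<in> V"
    using countable_cover by blast
  have "(\<lambda>x. - d + x) -` V \<in> null_sets \<mu>" for d
    using V0 assms by (auto simp: null_sets_def emeasure_trans_vimage intro!: open_sets open_vimage cont_ltrans)
  then have "(\<Union>d\<in>D. (\<lambda>x. - d + x) -` V) \<in> null_sets \<mu>"
    using D(1) by (intro null_sets_UN') auto
  moreover have "(\<Union>d\<in>D. (\<lambda>x. - d + x) -` V) = UNIV"
    using D(2)[OF assms] by auto
  ultimately have "emeasure \<mu> UNIV = 0" by auto
  then show False using positive by simp
qed

sublocale pair_sigma_finite \<mu> \<mu>
  by (simp add: pair_sigma_finite_def sigma_finite)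

section \<open>Sets with product measurable division preimage\<close>

text \<open>
  The additively written \<open>- y + x\<close> is $y^{-1} x$. For a group that is not second countable the
  second conjunct may fail to follow from the first, since an open subset of the product of the group
  with itself need not belong to the product of the Borel algebras.
\<close>

definition diff_measurable :: "'a set \<Rightarrow> bool" where
  "diff_measurable N \<longleftrightarrow> N \<in> sets \<mu> \<and> {z. - fst z + snd z \<in> N} \<in> sets (\<mu> \<Otimes>\<^sub>M \<mu>)"

text \<open>
  The set $N$ is a countable intersection $\bigcap_n V_n C$ for rapidly shrinking
  neighbourhoods $V_n$ of the identity. It behaves like a set pulled back from a metrizable
  quotient: up to passing from $V_n$ to $V_{n+1}$, the condition $y^{-1} x \in V_n C$ can be
  tested on the countably many rectangles $d V_{n+1} \times d V_{n+1} V_{n+1} C$ with $d$ in a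
  dense set, and the loss disappears in the intersection.
\<close>

lemma diff_measurable_between:
  assumes C: "compact C" and U: "open U" "C \<subseteq> U"
  shows "\<exists>N. diff_measurable N \<and> C \<subseteq> N \<and> N \<subseteq> U"
proof -
  obtain V0 :: "'a set" where V0: "open V0" "0 \<in> V0" "\<forall>v\<in>V0. \<forall>c\<in>C. v + c \<in> U"
    using compact_left_neighbourhood[OF C U] by blast
  obtain F :: "'a set \<Rightarrow> 'a set" where
    F: "\<And>U. open U \<Longrightarrow> 0 \<in> U \<Longrightarrow>
       open (F U) \<and> 0 \<in> F U \<and> (\<forall>a\<in>F U. \<forall>b\<in>F U. \<forall>c\<in>F U. - a + b + c \<in> U)"
    using open_triple_neighbourhood by metis
  define V where "V n = (F ^^ n) V0" for n
  have V: "open (V n) \<and> 0 \<in> V n" for n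
  proof (induction n)
    case 0 show ?case using V0 by (simp add: V_def)
  next
    case (Suc n) then show ?case using F[of "V n"] by (simp add: V_def)
  qed
  have Vstep: "- a + b + c \<in> V n" if "a \<in> V (Suc n)" "b \<in> V (Suc n)" "c \<in> V (Suc n)" for a b c n
    using F[of "V n"] V[of n] that by (simp add: V_def)
  \<comment> \<open>In multiplicative notation \<open>W n\<close> is $V_n C$ and \<open>W2 n\<close> is $V_n V_n C$.\<close>
  define W where "W n = (\<Union>c\<in>C. (\<lambda>x. x - c) -` V n)" for n
  define W2 where "W2 n = (\<Union>c\<in>C. \<Union>v\<in>V n. (\<lambda>x. x - (v + c)) -` V n)" for n
  have W: "open (W n)" "open (W2 n)" for n
    unfolding W_def W2_def using V by (auto intro!: open_UN open_vimage cont_sub)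
  obtain D :: "'a set" where D: "countable D" "\<And>V x. open V \<Longrightarrow> 0 \<in> V \<Longrightarrow> \<exists>d\<in>D. - d + x \<in> V"
    using countable_cover by blast
  define R where
    "R n = (\<Union>d\<in>D. ((\<lambda>y. - d + y) -` V (Suc n)) \<times> ((\<lambda>x. - d + x) -` W2 (Suc n)))" for n
  define N where "N = (\<Inter>n. W n)"
  have "((\<lambda>y. - d + y) -` V (Suc n)) \<times> ((\<lambda>x. - d + x) -` W2 (Suc n)) \<in> sets (\<mu> \<Otimes>\<^sub>M \<mu>)" for d n
    by (rule pair_measureI; rule open_sets; rule open_vimage[OF _ cont_ltrans]; simp add: V W)
  then have "R n \<in> sets (\<mu> \<Otimes>\<^sub>M \<mu>)" for n
    unfolding R_def using D(1) by (intro sets.countable_UN') auto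
  moreover have "{z. - fst z + snd z \<in> N} = (\<Inter>n. R n)"
  proof (intro set_eqI iffI; clarsimp)
    fix y x n assume "- y + x \<in> N"
    then obtain c where c: "c \<in> C" "- y + x - c \<in> V (Suc n)"
      by (auto simp: N_def W_def)
    obtain d where d: "d \<in> D" "- d + y \<in> V (Suc n)"
      using D(2)[of "V (Suc n)" y] V by blast
    have "- d + x - ((- y + x - c) + c) = - d + y" for c
      by (simp add: diff_conv_add_uminus minus_add add.assoc del: add_uminus_conv_diff)
    then have "- d + x \<in> (\<lambda>u. u - ((- y + x - c) + c)) -` V (Suc n)"
      using d by simp
    then have "- d + x \<in> W2 (Suc n)"
      unfolding W2_def using c by blast
    then show "(y, x) \<in> R n" using d by (auto simp: R_def)
  next
    fix y x assume R: "\<forall>n. (y, x) \<in> R n"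
    have "- y + x \<in> W n" for n
    proof -
      obtain d c v where "- d + y \<in> V (Suc n)" "c \<in> C" "v \<in> V (Suc n)" "- d + x - (v + c) \<in> V (Suc n)"
        using R[THEN spec, of n] by (auto simp: R_def W2_def)
      moreover from this have "- (- d + y) + (- d + x - (v + c)) + v \<in> V n"
        using Vstep by blast
      moreover have "- (- d + y) + (- d + x - (v + c)) + v = - y + x - c"
        by (simp add: diff_conv_add_uminus minus_add add.assoc del: add_uminus_conv_diff)
      ultimately show ?thesis by (auto simp: W_def)
    qed
    then show "- y + x \<in> N" by (simp add: N_def)
  qed
  moreover have "N \<in> sets \<mu>"
    unfolding N_def using W by auto
  ultimately have "diff_measurable N"
    by (auto simp: diff_measurable_def)
  moreover have "C \<subseteq> N"
  proof
    fix c assume "c \<in> C"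
    then have "c \<in> W n" for n
      unfolding W_def using V[of n] by (intro UN_I[of c]) auto
    then show "c \<in> N" by (simp add: N_def)
  qed
  moreover have "N \<subseteq> U"
  proof
    fix x assume "x \<in> N"
    then have "x \<in> W 0" by (simp add: N_def)
    then obtain c where "c \<in> C" "x - c \<in> V0"
      by (auto simp: W_def V_def)
    then have "x - c + c \<in> U" using V0(3) by blast
    then show "x \<in> U" by simp
  qed
  ultimately show ?thesis by blast
qed

lemma diff_measurable_indicator:
  assumes "diff_measurable N"
  shows "(\<lambda>z. indicator N (- fst z + snd z) :: ennreal) \<in> borel_measurable (\<mu> \<Otimes>\<^sub>M \<mu>)"
proof -
  have "(\<lambda>z. indicator N (- fst z + snd z) :: ennreal) = indicator {z. - fst z + snd z \<in> N}"
    by (auto simp: indicator_def)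
  moreover have "(indicator {z. - fst z + snd z \<in> N} :: _ \<Rightarrow> ennreal) \<in> borel_measurable (\<mu> \<Otimes>\<^sub>M \<mu>)"
    using assms by (intro borel_measurable_indicator) (simp add: diff_measurable_def)
  ultimately show ?thesis by simp
qed

lemma diff_measurable_UN:
  assumes "\<And>n::nat. diff_measurable (N n)"
  shows "diff_measurable (\<Union>n. N n)"
proof -
  have "{z. - fst z + snd z \<in> (\<Union>n. N n)} = (\<Union>n. {z. - fst z + snd z \<in> N n})"
    by auto
  then show ?thesis
    using assms by (auto simp: diff_measurable_def)
qed

lemma diff_measurable_Compl:
  assumes "diff_measurable N"
  shows "diff_measurable (- N)"
proof -
  have "{z. - fst z + snd z \<in> - N} = space (\<mu> \<Otimes>\<^sub>M \<mu>) - {z. - fst z + snd z \<in> N}"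
    by (auto simp: space_pair_measure)
  then show ?thesis
    using assms sets.compl_sets[of N \<mu>] by (auto simp: diff_measurable_def Compl_eq_Diff_UNIV)
qed

text \<open>
  Exhaust $U$ in measure by a sequence of compact sets and squeeze a division measurable set
  between each of them and $U$.
\<close>

lemma finite_open_AE_diff_measurable:
  assumes U: "open U" and fin: "emeasure \<mu> U < \<infinity>"
  shows "\<exists>N. diff_measurable N \<and> (AE x in \<mu>. x \<in> U \<longleftrightarrow> x \<in> N)"
proof -
  let ?K = "{K. compact K \<and> K \<subseteq> U}"
  have "emeasure \<mu> ` ?K \<noteq> {}" by (auto intro!: exI[of _ "{}"])
  from ennreal_Sup_countable_SUP[OF this] obtain f :: "nat \<Rightarrow> ennreal" where
    f: "range f \<subseteq> emeasure \<mu> ` ?K" "(SUP K\<in>?K. emeasure \<mu> K) = (SUP i. f i)" by auto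
  from f(1) have "\<forall>i. \<exists>K\<in>?K. f i = emeasure \<mu> K" by auto
  then obtain K where K: "\<And>i. compact (K i)" "\<And>i. K i \<subseteq> U" "\<And>i. f i = emeasure \<mu> (K i)"
    by (metis (mono_tags, lifting) mem_Collect_eq)
  obtain N where N: "\<And>i. diff_measurable (N i)" "\<And>i. K i \<subseteq> N i" "\<And>i. N i \<subseteq> U"
    using diff_measurable_between[OF K(1) U K(2)] by metis
  define N' where "N' = (\<Union>i::nat. N i)"
  have N': "diff_measurable N'" "N' \<subseteq> U"
    unfolding N'_def by (intro diff_measurable_UN N(1)) (use N(3) in blast)
  then have [measurable]: "N' \<in> sets \<mu>" "U \<in> sets \<mu>"
    using U open_sets by (auto simp: diff_measurable_def)
  have "emeasure \<mu> U = (SUP i. f i)"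
    using inner_regular[OF U] f(2) by simp
  also have "\<dots> \<le> emeasure \<mu> N'"
  proof (rule SUP_least)
    fix i
    have "K i \<subseteq> N'" using N(2)[of i] by (auto simp: N'_def)
    then show "f i \<le> emeasure \<mu> N'"
      by (simp add: K(3) emeasure_mono)
  qed
  finally have eq: "emeasure \<mu> N' = emeasure \<mu> U"
    using emeasure_mono[OF N'(2), of \<mu>] by simp
  have "emeasure \<mu> (U - N') = emeasure \<mu> U - emeasure \<mu> N'"
    using N'(2) eq fin by (intro emeasure_Diff) auto
  then have "emeasure \<mu> (U - N') = 0"
    using eq fin by simp
  then have "U - N' \<in> null_sets \<mu>" by auto
  from AE_not_in[OF this] have "AE x in \<mu>. x \<in> U \<longleftrightarrow> x \<in> N'"
    by eventually_elim (use N'(2) in auto)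
  then show ?thesis using N'(1) by blast
qed

lemma UN_AE_diff_measurable:
  assumes "\<And>i::nat. \<exists>N. diff_measurable N \<and> (AE x in \<mu>. x \<in> A i \<longleftrightarrow> x \<in> N)"
  shows "\<exists>N. diff_measurable N \<and> (AE x in \<mu>. x \<in> (\<Union>i. A i) \<longleftrightarrow> x \<in> N)"
proof -
  obtain N where N: "\<And>i. diff_measurable (N i)" "\<And>i. AE x in \<mu>. x \<in> A i \<longleftrightarrow> x \<in> N i"
    using assms by metis
  then have "AE x in \<mu>. \<forall>i. x \<in> A i \<longleftrightarrow> x \<in> N i"
    by (simp add: AE_all_countable)
  then have "AE x in \<mu>. x \<in> (\<Union>i. A i) \<longleftrightarrow> x \<in> (\<Union>i. N i)"
    by eventually_elim auto
  then show ?thesis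
    by (intro exI[of _ "\<Union>i. N i"] conjI diff_measurable_UN N(1))
qed

lemma open_AE_diff_measurable:
  assumes U: "open U"
  shows "\<exists>N. diff_measurable N \<and> (AE x in \<mu>. x \<in> U \<longleftrightarrow> x \<in> N)"
proof -
  obtain D :: "'a set" where D: "countable D" "\<And>V x. open V \<Longrightarrow> 0 \<in> V \<Longrightarrow> \<exists>d\<in>D. - d + x \<in> V"
    using countable_cover by blast
  obtain V :: "'a set" where V: "open V" "0 \<in> V" "emeasure \<mu> V < \<infinity>"
    using finite_neighbourhood by blast
  have "D \<noteq> {}" using D(2)[OF V(1,2)] by auto
  then obtain d :: "nat \<Rightarrow> 'a" where d: "D = range d"
    using D(1) uncountable_def by blast
  define A where "A i = U \<inter> (\<lambda>x. - d i + x) -` V" for i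
  have "\<exists>N. diff_measurable N \<and> (AE x in \<mu>. x \<in> A i \<longleftrightarrow> x \<in> N)" for i
  proof (rule finite_open_AE_diff_measurable)
    have op: "open ((\<lambda>x. - d i + x) -` V)"
      by (rule open_vimage[OF V(1) cont_ltrans])
    then show "open (A i)" using U by (auto simp: A_def)
    have "emeasure \<mu> (A i) \<le> emeasure \<mu> ((\<lambda>x. - d i + x) -` V)"
      unfolding A_def using op by (intro emeasure_mono open_sets) auto
    also have "\<dots> < \<infinity>" using V open_sets by (simp add: emeasure_trans_vimage)
    finally show "emeasure \<mu> (A i) < \<infinity>" .
  qed
  then have "\<exists>N. diff_measurable N \<and> (AE x in \<mu>. x \<in> (\<Union>i. A i) \<longleftrightarrow> x \<in> N)"
    by (rule UN_AE_diff_measurable)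
  moreover have "(\<Union>i. A i) = U"
    using D(2)[OF V(1,2)] by (auto simp: A_def d)
  ultimately show ?thesis by simp
qed

text \<open>
  Sets that agree almost everywhere with a division measurable set form a \<open>\<sigma>\<close>-algebra, so open
  sets suffice; these are reduced to finite measure by the countable cover.
\<close>

lemma set_AE_diff_measurable:
  assumes "A \<in> sets \<mu>"
  shows "\<exists>N. diff_measurable N \<and> (AE x in \<mu>. x \<in> A \<longleftrightarrow> x \<in> N)"
proof -
  have "A \<in> sigma_sets UNIV {S. open S}"
    using assms by (simp add: sets_mu borel_def)
  then show ?thesis
  proof induction
    case (Basic A) then show ?case using open_AE_diff_measurable by simp
  next
    case Empty show ?case using open_AE_diff_measurable[of "{}"] by simp
  next
    case (Compl A)
    then obtain N where N: "diff_measurable N" "AE x in \<mu>. x \<in> A \<longleftrightarrow> x \<in> N" by blast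
    from N(2) have "AE x in \<mu>. x \<in> UNIV - A \<longleftrightarrow> x \<in> - N" by eventually_elim auto
    then show ?case by (intro exI[of _ "- N"] conjI diff_measurable_Compl N(1))
  next
    case (Union A) then show ?case by (intro UN_AE_diff_measurable)
  qed
qed

section \<open>Invariance under inversion\<close>

text \<open>
  Evaluate $\int\!\!\int 1_A(y) 1_B(y^{-1} x)\,dy\,dx$ in two ways for some $A$ of
  finite positive measure. Integrating over $x$ first gives $\mu(A) \mu(B)$ by left invariance.
  Substituting $y \mapsto xy$ turns the integrand into $1_A(xy) 1_B(y^{-1})$, whose integral over
  $x$ first is $\mu(A) \mu(B^{-1})$ by right invariance. Both evaluations use Tonelli's theorem,
  hence the measurability assumption on $B$; \<open>distr_inv\<close> passes to all Borel sets by regularity.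
\<close>

lemma emeasure_inv_diff_measurable:
  assumes B: "diff_measurable B"
  shows "emeasure \<mu> (uminus -` B) = emeasure \<mu> B"
proof -
  have "0 < emeasure \<mu> UNIV"
    using positive by (simp add: zero_less_iff_neq_zero)
  then obtain C where C: "compact C" "0 < emeasure \<mu> C"
    using inner_compact[of UNIV 0] by auto
  obtain U where U: "open U" "C \<subseteq> U" "emeasure \<mu> U < \<infinity>"
    using outer_open[OF compact_sets[OF C(1)] compact_finite[OF C(1)]] by blast
  obtain A where A: "diff_measurable A" "C \<subseteq> A" "A \<subseteq> U"
    using diff_measurable_between[OF C(1) U(1,2)] by blast
  have [measurable]: "A \<in> sets \<mu>" "B \<in> sets \<mu>"
    using A B by (auto simp: diff_measurable_def)
  have A0: "emeasure \<mu> A \<noteq> 0"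
    using C A emeasure_mono[of C A \<mu>] by (auto simp: diff_measurable_def)
  have Afin: "emeasure \<mu> A \<noteq> \<infinity>"
    using U A emeasure_mono[of A U \<mu>] by (auto simp: open_sets)
  note [measurable] = diff_measurable_indicator[OF B]
  have "(\<lambda>z. (- fst z, snd z)) \<in> \<mu> \<Otimes>\<^sub>M \<mu> \<rightarrow>\<^sub>M \<mu> \<Otimes>\<^sub>M \<mu>" by measurable
  from measurable_compose[OF this diff_measurable_indicator[OF A(1)]]
  have [measurable]: "(\<lambda>z. indicator A (fst z + snd z) :: ennreal) \<in> borel_measurable (\<mu> \<Otimes>\<^sub>M \<mu>)"
    by simp
  have "emeasure \<mu> A * emeasure \<mu> B = (\<integral>\<^sup>+y. \<integral>\<^sup>+x. indicator A y * indicator B (- y + x) \<partial>\<mu> \<partial>\<mu>)"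
    by (simp add: nn_integral_cmult nn_integral_ltrans[of "indicator B"] nn_integral_multc)
  also have "\<dots> = (\<integral>\<^sup>+x. \<integral>\<^sup>+y. indicator A y * indicator B (- y + x) \<partial>\<mu> \<partial>\<mu>)"
    by (rule Fubini'[symmetric]) (simp add: case_prod_beta)
  also have "\<dots> = (\<integral>\<^sup>+x. \<integral>\<^sup>+y. indicator A (x + y) * indicator B (- y) \<partial>\<mu> \<partial>\<mu>)"
  proof (rule nn_integral_cong)
    fix x
    show "(\<integral>\<^sup>+y. indicator A y * indicator B (- y + x) \<partial>\<mu>) = (\<integral>\<^sup>+y. indicator A (x + y) * indicator B (- y) \<partial>\<mu>)"
      using nn_integral_ltrans[of "\<lambda>y. indicator A y * indicator B (- y + x)" x]
      by (simp add: minus_add add.assoc)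
  qed
  also have "\<dots> = (\<integral>\<^sup>+y. \<integral>\<^sup>+x. indicator A (x + y) * indicator B (- y) \<partial>\<mu> \<partial>\<mu>)"
    by (rule Fubini'[symmetric]) (simp add: case_prod_beta)
  also have "\<dots> = (\<integral>\<^sup>+y. emeasure \<mu> A * indicator B (- y) \<partial>\<mu>)"
    by (simp add: nn_integral_multc nn_integral_rtrans[of "indicator A"])
  also have "\<dots> = emeasure \<mu> A * (\<integral>\<^sup>+y. indicator (uminus -` B) y \<partial>\<mu>)"
    by (simp add: nn_integral_cmult indicator_vimage comp_def indicator_def)
  also have "\<dots> = emeasure \<mu> A * emeasure \<mu> (uminus -` B)"
    using measurable_sets[of "\<lambda>x. - x" \<mu> \<mu> B] by simp
  finally show ?thesis using A0 Afin by (simp add: ennreal_mult_cancel_left)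
qed

lemma distr_inv: "distr \<mu> \<mu> uminus = \<mu>"
proof -
  have opn: "emeasure \<mu> (uminus -` U) \<le> emeasure \<mu> U" if U: "open U" for U
  proof -
    have "open (uminus -` U)"
      using U cont_inv by (rule open_vimage)
    moreover have "emeasure \<mu> C \<le> emeasure \<mu> U" if C: "compact C" "C \<subseteq> uminus -` U" for C
    proof -
      have "compact (uminus ` C)"
        using C(1) by (intro compact_continuous_image continuous_on_subset[OF cont_inv]) auto
      moreover have "uminus ` C \<subseteq> U" using C by auto
      ultimately obtain N where N: "diff_measurable N" "uminus ` C \<subseteq> N" "N \<subseteq> U"
        using diff_measurable_between U by blast
      have [measurable]: "N \<in> sets \<mu>" using N by (simp add: diff_measurable_def)
      have "emeasure \<mu> C \<le> emeasure \<mu> (uminus -` N)"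
        using N measurable_sets[of "\<lambda>x. - x" \<mu> \<mu> N] by (intro emeasure_mono) auto
      also have "\<dots> \<le> emeasure \<mu> U"
        using N emeasure_inv_diff_measurable U by (simp add: emeasure_mono open_sets)
      finally show ?thesis .
    qed
    ultimately show ?thesis using inner_regular by (auto intro!: SUP_least)
  qed
  have le: "emeasure \<mu> (uminus -` E) \<le> emeasure \<mu> E" if E: "E \<in> sets \<mu>" for E
  proof -
    have "emeasure \<mu> (uminus -` E) \<le> emeasure \<mu> U" if U: "open U" "E \<subseteq> U" for U
    proof -
      have "emeasure \<mu> (uminus -` E) \<le> emeasure \<mu> (uminus -` U)"
        using U cont_inv by (intro emeasure_mono open_sets open_vimage) auto
      with opn[OF U(1)] show ?thesis by simp
    qed
    then show ?thesis using outer_regular[OF E] by (auto intro!: INF_greatest)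
  qed
  show ?thesis
  proof (rule measure_eqI)
    fix E assume "E \<in> sets (distr \<mu> \<mu> uminus)"
    then have E: "E \<in> sets \<mu>" by simp
    have E': "uminus -` E \<in> sets \<mu>" using measurable_sets[of "\<lambda>x. - x" \<mu> \<mu> E] E by simp
    have "uminus -` uminus -` E = E" by auto
    then have "emeasure \<mu> (uminus -` E) = emeasure \<mu> E"
      using le[OF E] le[OF E'] by simp
    then show "emeasure (distr \<mu> \<mu> uminus) E = emeasure \<mu> E"
      using E by (simp add: emeasure_distr)
  qed simp
qed

lemma distr_reflect: "distr \<mu> \<mu> (\<lambda>y. - y + x) = \<mu>"
proof -
  have "distr (distr \<mu> \<mu> uminus) \<mu> (\<lambda>y. y + x) = distr \<mu> \<mu> ((\<lambda>y. y + x) \<circ> uminus)"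
    by (rule distr_distr) auto
  then show ?thesis by (simp add: distr_inv distr_rtrans comp_def)
qed

lemma nn_integral_reflect:
  assumes [measurable]: "w \<in> borel_measurable \<mu>"
  shows "(\<integral>\<^sup>+y. w (- y + x) \<partial>\<mu>) = (\<integral>\<^sup>+y. w y \<partial>\<mu>)"
  using nn_integral_distr[of "\<lambda>y. - y + x" \<mu> \<mu> w] by (simp add: distr_reflect)

lemma AE_reflect:
  assumes "AE y in \<mu>. P y"
  shows "AE y in \<mu>. P (- y + x)"
  by (rule AE_distrD[where M'=\<mu> and f="\<lambda>y. - y + x"]) (auto simp only: distr_reflect assms measurable_trans)

section \<open>Product measurable representatives of functions\<close>

text \<open>
  The function $u$ arises from indicators by countably many sums and suprema; choose a
  representative of every indicator. The countably many exceptional null sets are harmless.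
\<close>

lemma nonneg_AE_diff_measurable:
  fixes u :: "'a \<Rightarrow> ennreal"
  assumes "u \<in> borel_measurable \<mu>"
  shows "\<exists>v. v \<in> borel_measurable \<mu> \<and> (\<lambda>z. v (- fst z + snd z)) \<in> borel_measurable (\<mu> \<Otimes>\<^sub>M \<mu>) \<and>
     (AE x in \<mu>. u x = v x)"
  using assms
proof (induction rule: borel_measurable_induct)
  case (cong f g)
  then show ?case by simp
next
  case (set A)
  then obtain N where N: "diff_measurable N" "AE x in \<mu>. x \<in> A \<longleftrightarrow> x \<in> N"
    using set_AE_diff_measurable by blast
  from N(2) have "AE x in \<mu>. (indicator A x :: ennreal) = indicator N x"
    by eventually_elim (auto simp: indicator_def)
  moreover have "N \<in> sets \<mu>" using N(1) by (simp add: diff_measurable_def)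
  ultimately show ?case
    using diff_measurable_indicator[OF N(1)] by (intro exI[of _ "indicator N"]) auto
next
  case (mult u c)
  then obtain v where [measurable]: "v \<in> borel_measurable \<mu>"
      "(\<lambda>z. v (- fst z + snd z)) \<in> borel_measurable (\<mu> \<Otimes>\<^sub>M \<mu>)" and v: "AE x in \<mu>. u x = v x" by blast
  have "AE x in \<mu>. c * u x = c * v x" using v by eventually_elim simp
  then show ?case by (intro exI[of _ "\<lambda>x. c * v x"] conjI) measurable
next
  case (add u u')
  then obtain v v' where [measurable]: "v \<in> borel_measurable \<mu>" "v' \<in> borel_measurable \<mu>"
      "(\<lambda>z. v (- fst z + snd z)) \<in> borel_measurable (\<mu> \<Otimes>\<^sub>M \<mu>)"
      "(\<lambda>z. v' (- fst z + snd z)) \<in> borel_measurable (\<mu> \<Otimes>\<^sub>M \<mu>)"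
    and v: "AE x in \<mu>. u x = v x" "AE x in \<mu>. u' x = v' x" by blast
  have "AE x in \<mu>. u' x + u x = v' x + v x" using v by eventually_elim simp
  then show ?case by (intro exI[of _ "\<lambda>x. v' x + v x"] conjI) measurable
next
  case (seq U)
  then obtain v where [measurable]: "\<And>i. v i \<in> borel_measurable \<mu>"
      "\<And>i. (\<lambda>z. v i (- fst z + snd z)) \<in> borel_measurable (\<mu> \<Otimes>\<^sub>M \<mu>)"
    and v: "\<And>i. AE x in \<mu>. U i x = v i x" by metis
  then have "AE x in \<mu>. \<forall>i. U i x = v i x" by (simp add: AE_all_countable)
  then have "AE x in \<mu>. (SUP i. U i) x = (SUP i. v i x)" by eventually_elim (simp add: image_comp)
  then show ?case by (intro exI[of _ "\<lambda>x. SUP i. v i x"] conjI) measurable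
qed

lemma complex_AE_diff_measurable:
  fixes f :: "'a \<Rightarrow> complex"
  assumes [measurable]: "f \<in> borel_measurable \<mu>"
  obtains g where "g \<in> borel_measurable \<mu>"
    "(\<lambda>z. g (- fst z + snd z)) \<in> borel_measurable (\<mu> \<Otimes>\<^sub>M \<mu>)" "AE x in \<mu>. f x = g x"
proof -
  have ex: "\<exists>v. v \<in> borel_measurable \<mu> \<and> (\<lambda>z. v (- fst z + snd z)) \<in> borel_measurable (\<mu> \<Otimes>\<^sub>M \<mu>) \<and>
     (AE x in \<mu>. ennreal (h (f x)) = v x)" if [measurable]: "h \<in> borel_measurable borel" for h
    by (rule nonneg_AE_diff_measurable) simp
  obtain a where [measurable]: "a \<in> borel_measurable \<mu>"
      "(\<lambda>z. a (- fst z + snd z)) \<in> borel_measurable (\<mu> \<Otimes>\<^sub>M \<mu>)" and a: "AE x in \<mu>. ennreal (Re (f x)) = a x"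
    using ex[of Re] by auto
  obtain b where [measurable]: "b \<in> borel_measurable \<mu>"
      "(\<lambda>z. b (- fst z + snd z)) \<in> borel_measurable (\<mu> \<Otimes>\<^sub>M \<mu>)" and b: "AE x in \<mu>. ennreal (- Re (f x)) = b x"
    using ex[of "\<lambda>z. - Re z"] by auto
  obtain c where [measurable]: "c \<in> borel_measurable \<mu>"
      "(\<lambda>z. c (- fst z + snd z)) \<in> borel_measurable (\<mu> \<Otimes>\<^sub>M \<mu>)" and c: "AE x in \<mu>. ennreal (Im (f x)) = c x"
    using ex[of Im] by auto
  obtain d where [measurable]: "d \<in> borel_measurable \<mu>"
      "(\<lambda>z. d (- fst z + snd z)) \<in> borel_measurable (\<mu> \<Otimes>\<^sub>M \<mu>)" and d: "AE x in \<mu>. ennreal (- Im (f x)) = d x"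
    using ex[of "\<lambda>z. - Im z"] by auto
  define g where "g x = complex_of_real (enn2real (a x) - enn2real (b x)) +
     \<i> * complex_of_real (enn2real (c x) - enn2real (d x))" for x
  have "AE x in \<mu>. f x = g x"
    using a b c d
  proof eventually_elim
    case (elim x)
    have "enn2real (ennreal t) - enn2real (ennreal (- t)) = t" for t
      by (cases "t \<ge> 0") (auto simp: ennreal_neg)
    then show ?case
      unfolding g_def elim[symmetric] by (simp add: complex_eq_iff)
  qed
  moreover have "g \<in> borel_measurable \<mu>"
    unfolding g_def by measurable
  moreover have "(\<lambda>z. g (- fst z + snd z)) \<in> borel_measurable (\<mu> \<Otimes>\<^sub>M \<mu>)"
    unfolding g_def by measurable
  ultimately show ?thesis using that by blast
qed

lemma diff_measurable_swap:
  assumes "(\<lambda>z. g (- fst z + snd z)) \<in> measurable (\<mu> \<Otimes>\<^sub>M \<mu>) N"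
  shows "(\<lambda>z. g (- snd z + fst z)) \<in> measurable (\<mu> \<Otimes>\<^sub>M \<mu>) N"
proof -
  have "(\<lambda>z. (snd z, fst z)) \<in> \<mu> \<Otimes>\<^sub>M \<mu> \<rightarrow>\<^sub>M \<mu> \<Otimes>\<^sub>M \<mu>" by measurable
  from measurable_compose[OF this assms] show ?thesis by simp
qed

end

section \<open>Convolution and Young inequalities\<close>

text \<open>
  The Cauchy-Schwarz inequality for the measure with density $w$ and the functions $u$ and $1$.
\<close>

lemma weighted_Cauchy_Schwarz:
  fixes u w :: "'b \<Rightarrow> ennreal"
  assumes [measurable]: "u \<in> borel_measurable M" "w \<in> borel_measurable M"
  shows "(\<integral>\<^sup>+x. u x * w x \<partial>M)\<^sup>2 \<le> (\<integral>\<^sup>+x. (u x)\<^sup>2 * w x \<partial>M) * (\<integral>\<^sup>+x. w x \<partial>M)"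
  using Cauchy_Schwarz_nn_integral[of u "density M w" "\<lambda>_. 1"]
  by (simp add: nn_integral_density mult.commute del: nn_integral_const)

context separable_unimodular_group
begin

text \<open>
  Convolution of nonnegative functions. All absolute convergence questions for \<open>convolution\<close> are
  settled by estimates of this majorant.
\<close>

definition nn_conv :: "('a \<Rightarrow> ennreal) \<Rightarrow> ('a \<Rightarrow> ennreal) \<Rightarrow> 'a \<Rightarrow> ennreal" where
  "nn_conv u v x = (\<integral>\<^sup>+y. u y * v (- y + x) \<partial>\<mu>)"

lemma nn_conv_cong_AE:
  assumes "AE y in \<mu>. v y = w y"
  shows "nn_conv u v x = nn_conv u w x"
  unfolding nn_conv_def
  by (rule nn_integral_cong_AE) (use AE_reflect[OF assms, of x] in \<open>eventually_elim, simp\<close>)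

lemma nn_conv_measurable [measurable]:
  assumes [measurable]: "u \<in> borel_measurable \<mu>" "v \<in> borel_measurable \<mu>"
  shows "nn_conv u v \<in> borel_measurable \<mu>"
proof -
  obtain w where wd: "(\<lambda>z. w (- fst z + snd z)) \<in> borel_measurable (\<mu> \<Otimes>\<^sub>M \<mu>)"
    and w: "AE x in \<mu>. v x = w x"
    using nonneg_AE_diff_measurable[OF assms(2)] by auto
  note [measurable] = diff_measurable_swap[OF wd]
  have "nn_conv u v = (\<lambda>x. \<integral>\<^sup>+y. u y * w (- y + x) \<partial>\<mu>)"
    using nn_conv_cong_AE[OF w] by (auto simp: nn_conv_def)
  also have "\<dots> \<in> borel_measurable \<mu>"
    by (rule M1.borel_measurable_nn_integral) (simp add: case_prod_beta)
  finally show ?thesis .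
qed

lemma nn_integral_conv:
  assumes [measurable]: "u \<in> borel_measurable \<mu>" "v \<in> borel_measurable \<mu>"
  shows "(\<integral>\<^sup>+x. nn_conv u v x \<partial>\<mu>) = (\<integral>\<^sup>+x. u x \<partial>\<mu>) * (\<integral>\<^sup>+x. v x \<partial>\<mu>)"
proof -
  obtain w where [measurable]: "w \<in> borel_measurable \<mu>"
     "(\<lambda>z. w (- fst z + snd z)) \<in> borel_measurable (\<mu> \<Otimes>\<^sub>M \<mu>)"
    and w: "AE x in \<mu>. v x = w x"
    using nonneg_AE_diff_measurable[OF assms(2)] by auto
  have "(\<integral>\<^sup>+x. nn_conv u v x \<partial>\<mu>) = (\<integral>\<^sup>+x. \<integral>\<^sup>+y. u y * w (- y + x) \<partial>\<mu> \<partial>\<mu>)"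
    using nn_conv_cong_AE[OF w] by (auto simp: nn_conv_def)
  also have "\<dots> = (\<integral>\<^sup>+y. \<integral>\<^sup>+x. u y * w (- y + x) \<partial>\<mu> \<partial>\<mu>)"
    by (rule Fubini') (simp add: case_prod_beta)
  also have "\<dots> = (\<integral>\<^sup>+y. u y * (\<integral>\<^sup>+x. w x \<partial>\<mu>) \<partial>\<mu>)"
    by (simp add: nn_integral_cmult nn_integral_ltrans[of w])
  also have "\<dots> = (\<integral>\<^sup>+x. u x \<partial>\<mu>) * (\<integral>\<^sup>+x. w x \<partial>\<mu>)"
    by (simp add: nn_integral_multc)
  also have "(\<integral>\<^sup>+x. w x \<partial>\<mu>) = (\<integral>\<^sup>+x. v x \<partial>\<mu>)"
    by (rule nn_integral_cong_AE) (use w in \<open>eventually_elim, simp\<close>)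
  finally show ?thesis .
qed

text \<open>
  Cauchy-Schwarz with the weight $v(y^{-1} x)$, whose mass is $\|v\|_1$ for every $x$ because the
  measure is invariant under $y \mapsto y^{-1} x$; then Tonelli.
\<close>

lemma Young_L2_L1:
  assumes [measurable]: "u \<in> borel_measurable \<mu>" "v \<in> borel_measurable \<mu>"
  shows "(\<integral>\<^sup>+x. (nn_conv u v x)\<^sup>2 \<partial>\<mu>) \<le> (\<integral>\<^sup>+x. (u x)\<^sup>2 \<partial>\<mu>) * (\<integral>\<^sup>+x. v x \<partial>\<mu>)\<^sup>2"
proof -
  have "(nn_conv u v x)\<^sup>2 \<le> nn_conv (\<lambda>y. (u y)\<^sup>2) v x * (\<integral>\<^sup>+x. v x \<partial>\<mu>)" for x
    using weighted_Cauchy_Schwarz[of u \<mu> "\<lambda>y. v (- y + x)"]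
    by (simp add: nn_conv_def nn_integral_reflect[of v])
  then have "(\<integral>\<^sup>+x. (nn_conv u v x)\<^sup>2 \<partial>\<mu>) \<le> (\<integral>\<^sup>+x. nn_conv (\<lambda>y. (u y)\<^sup>2) v x * (\<integral>\<^sup>+x. v x \<partial>\<mu>) \<partial>\<mu>)"
    by (intro nn_integral_mono) auto
  also have "\<dots> = (\<integral>\<^sup>+x. (u x)\<^sup>2 \<partial>\<mu>) * (\<integral>\<^sup>+x. v x \<partial>\<mu>)\<^sup>2"
    by (simp add: nn_integral_multc nn_integral_conv power2_eq_square mult.assoc)
  finally show ?thesis .
qed

lemma Young_L1_L2:
  assumes [measurable]: "u \<in> borel_measurable \<mu>" "v \<in> borel_measurable \<mu>"
  shows "(\<integral>\<^sup>+x. (nn_conv u v x)\<^sup>2 \<partial>\<mu>) \<le> (\<integral>\<^sup>+x. u x \<partial>\<mu>)\<^sup>2 * (\<integral>\<^sup>+x. (v x)\<^sup>2 \<partial>\<mu>)"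
proof -
  have "(nn_conv u v x)\<^sup>2 \<le> nn_conv u (\<lambda>y. (v y)\<^sup>2) x * (\<integral>\<^sup>+x. u x \<partial>\<mu>)" for x
    using weighted_Cauchy_Schwarz[of "\<lambda>y. v (- y + x)" \<mu> u]
    by (simp add: nn_conv_def mult.commute)
  then have "(\<integral>\<^sup>+x. (nn_conv u v x)\<^sup>2 \<partial>\<mu>) \<le> (\<integral>\<^sup>+x. nn_conv u (\<lambda>y. (v y)\<^sup>2) x * (\<integral>\<^sup>+x. u x \<partial>\<mu>) \<partial>\<mu>)"
    by (intro nn_integral_mono) auto
  also have "\<dots> = (\<integral>\<^sup>+x. u x \<partial>\<mu>)\<^sup>2 * (\<integral>\<^sup>+x. (v x)\<^sup>2 \<partial>\<mu>)"
    by (subst nn_integral_multc) (simp_all add: nn_integral_conv power2_eq_square mult_ac)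
  finally show ?thesis .
qed

lemma Young_L2_L2:
  assumes [measurable]: "u \<in> borel_measurable \<mu>" "v \<in> borel_measurable \<mu>"
  shows "(nn_conv u v x)\<^sup>2 \<le> (\<integral>\<^sup>+x. (u x)\<^sup>2 \<partial>\<mu>) * (\<integral>\<^sup>+x. (v x)\<^sup>2 \<partial>\<mu>)"
  using Cauchy_Schwarz_nn_integral[of u \<mu> "\<lambda>y. v (- y + x)"]
  by (simp add: nn_conv_def nn_integral_reflect[of "\<lambda>x. (v x)\<^sup>2"])

lemma convolution_cong_AE:
  assumes [measurable]: "h \<in> borel_measurable \<mu>" "f \<in> borel_measurable \<mu>" "g \<in> borel_measurable \<mu>"
    and fg: "AE y in \<mu>. f y = g y"
  shows "convolution \<mu> h f = convolution \<mu> h g"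
proof
  fix x
  have "AE y in \<mu>. h y * f (- y + x) = h y * g (- y + x)"
    using AE_reflect[OF fg, of x] by eventually_elim simp
  then show "convolution \<mu> h f x = convolution \<mu> h g x"
    unfolding convolution_def by (intro integral_cong_AE) auto
qed

lemma convolution_measurable [measurable]:
  assumes [measurable]: "h \<in> borel_measurable \<mu>" "f \<in> borel_measurable \<mu>"
  shows "convolution \<mu> h f \<in> borel_measurable \<mu>"
proof -
  obtain g where [measurable]: "g \<in> borel_measurable \<mu>"
      and gd: "(\<lambda>z. g (- fst z + snd z)) \<in> borel_measurable (\<mu> \<Otimes>\<^sub>M \<mu>)"
      and g: "AE x in \<mu>. f x = g x"
    using complex_AE_diff_measurable[OF assms(2)] .
  note [measurable] = diff_measurable_swap[OF gd]
  have "(\<lambda>x. \<integral>y. h y * g (- y + x) \<partial>\<mu>) \<in> borel_measurable \<mu>"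
    by (rule M1.borel_measurable_lebesgue_integral) (simp add: case_prod_beta)
  then show ?thesis
    using convolution_cong_AE[OF _ _ _ g, of h] by (simp add: convolution_def[abs_def])
qed

text \<open>
  Where the integral does not converge absolutely, \<open>convolution\<close> has the value $0$, and the
  bound holds there as well.
\<close>

lemma norm_convolution_le:
  "ennreal (norm (convolution \<mu> h f x)) \<le> nn_conv (\<lambda>y. ennreal (norm (h y))) (\<lambda>y. ennreal (norm (f y))) x"
proof (cases "integrable \<mu> (\<lambda>y. h y * f (- y + x))")
  case True
  from integral_norm_bound_ennreal[OF this] show ?thesis
    by (simp add: convolution_def nn_conv_def norm_mult ennreal_mult)
next
  case False
  then show ?thesis by (simp add: convolution_def not_integrable_integral_eq)
qed

section \<open>Translation continuity and approximate identities\<close>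

text \<open>
  By regularity $A$ is close in measure to an open $U \supseteq A$, and $U$ to a
  compact $C \subseteq U$. A small translation keeps $C$ inside $U$, and the translate of $C$
  still fills $U$ up to a small measure.
\<close>

lemma translated_set_close:
  assumes A: "A \<in> sets \<mu>" "emeasure \<mu> A < \<infinity>" and e: "(e::real) > 0"
  shows "\<exists>V. open V \<and> 0 \<in> V \<and> (\<forall>y\<in>V. emeasure \<mu> {x. (- y + x \<in> A) \<noteq> (x \<in> A)} \<le> ennreal e)"
proof -
  \<comment> \<open>The difference will be covered by four error sets, each of measure at most \<open>d\<close>.\<close>
  define d where "d = e / 4"
  have d: "d > 0" using e by (simp add: d_def)
  have "emeasure \<mu> A < emeasure \<mu> A + ennreal d"
    using A(2) d by (simp add: ennreal_add_left_cancel_less[of _ 0, simplified])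
  from outer_open[OF A(1) this]
  obtain U where U: "open U" "A \<subseteq> U" "emeasure \<mu> U < emeasure \<mu> A + ennreal d" by blast
  have Ufin: "emeasure \<mu> U < \<infinity>" using U(3) A(2) by (metis ennreal_add_eq_top ennreal_neq_top infinity_ennreal_def less_top not_less_iff_gr_or_eq order.strict_trans)
  obtain C where C: "compact C" "C \<subseteq> U" "emeasure \<mu> U \<le> emeasure \<mu> C + ennreal d"
  proof (cases "emeasure \<mu> U = 0")
    case True
    then show ?thesis using that[of "{}"] by simp
  next
    case False
    then have "emeasure \<mu> U - ennreal d < emeasure \<mu> U"
      using Ufin d by (intro ennreal_between) (auto simp: zero_less_iff_neq_zero)
    from inner_compact[OF U(1) this] obtain C
      where "compact C" "C \<subseteq> U" "emeasure \<mu> U - ennreal d < emeasure \<mu> C" by blast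
    then show ?thesis using that[of C] by (auto simp: ennreal_minus_le_iff add.commute dest!: less_imp_le)
  qed
  have [measurable]: "U \<in> sets \<mu>" "C \<in> sets \<mu>" "A \<in> sets \<mu>"
    using open_sets[OF U(1)] compact_sets[OF C(1)] A(1) .
  obtain V where V: "open V" "0 \<in> V" "\<forall>v\<in>V. \<forall>c\<in>C. v + c \<in> U"
    using compact_left_neighbourhood[OF C(1) U(1) C(2)] by blast
  have diff: "emeasure \<mu> (U - B) \<le> ennreal d"
    if "B \<in> sets \<mu>" "B \<subseteq> U" "emeasure \<mu> U \<le> emeasure \<mu> B + ennreal d" for B
  proof -
    have "emeasure \<mu> B \<le> emeasure \<mu> U" using that(2) by (rule emeasure_mono) simp
    then have "emeasure \<mu> (U - B) = emeasure \<mu> U - emeasure \<mu> B"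
      using that Ufin by (intro emeasure_Diff) auto
    then show ?thesis using that(3) Ufin by (auto simp: ennreal_minus_le_iff)
  qed
  have "emeasure \<mu> {x. (- y + x \<in> A) \<noteq> (x \<in> A)} \<le> ennreal e" if y: "y \<in> V" for y
  proof -
    let ?t = "\<lambda>x. - y + x"
    have [measurable]: "?t -` B \<in> sets \<mu>" if "B \<in> sets \<mu>" for B
      using measurable_sets[OF measurable_trans(1) that, of "- y"] by simp
    have CU: "?t -` C \<subseteq> U"
    proof
      fix x assume "x \<in> ?t -` C"
      then have "y + (- y + x) \<in> U" using V(3) y by blast
      then show "x \<in> U" by (simp add: add.assoc[symmetric])
    qed
    have sub: "{x. (- y + x \<in> A) \<noteq> (x \<in> A)} \<subseteq>
        ((?t -` (U - A) \<union> ?t -` (U - C)) \<union> (U - ?t -` C)) \<union> (U - A)"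
    proof
      fix x assume "x \<in> {x. (- y + x \<in> A) \<noteq> (x \<in> A)}"
      moreover have "- y + x \<in> C \<Longrightarrow> x \<in> U" using CU by blast
      moreover have "- y + x \<in> A \<Longrightarrow> - y + x \<in> U" "x \<in> A \<Longrightarrow> x \<in> U" using U(2) by blast+
      ultimately show "x \<in> ((?t -` (U - A) \<union> ?t -` (U - C)) \<union> (U - ?t -` C)) \<union> (U - A)"
        using C(2) by auto
    qed
    have m: "?t -` (U - A) \<in> sets \<mu>" "?t -` (U - C) \<in> sets \<mu>" "U - ?t -` C \<in> sets \<mu>" "U - A \<in> sets \<mu>"
      by measurable
    have "emeasure \<mu> {x. (- y + x \<in> A) \<noteq> (x \<in> A)} \<le>
        emeasure \<mu> (((?t -` (U - A) \<union> ?t -` (U - C)) \<union> (U - ?t -` C)) \<union> (U - A))"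
      using m by (intro emeasure_mono sub) auto
    also have "\<dots> \<le> ((emeasure \<mu> (?t -` (U - A)) + emeasure \<mu> (?t -` (U - C))) + emeasure \<mu> (U - ?t -` C)) + emeasure \<mu> (U - A)"
      using m by (intro order.trans[OF emeasure_subadditive] add_mono order.refl sets.Un) auto
    also have "\<dots> \<le> ((ennreal d + ennreal d) + ennreal d) + ennreal d"
    proof (intro add_mono)
      show UA: "emeasure \<mu> (U - A) \<le> ennreal d"
        using U by (intro diff) auto
      show "emeasure \<mu> (?t -` (U - A)) \<le> ennreal d"
        using UA emeasure_trans_vimage[of "U - A" "- y"] by simp
      show "emeasure \<mu> (?t -` (U - C)) \<le> ennreal d"
        using diff[of C] C emeasure_trans_vimage[of "U - C" "- y"] by simp
      show "emeasure \<mu> (U - ?t -` C) \<le> ennreal d"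
        using C CU emeasure_trans_vimage[of C "- y"] by (intro diff) auto
    qed
    also have "\<dots> = ennreal e"
      using d by (simp add: ennreal_plus[symmetric] d_def del: ennreal_plus)
    finally show ?thesis .
  qed
  then show ?thesis using V(1,2) by blast
qed

lemma integrable_reflect:
  fixes f :: "'a \<Rightarrow> complex"
  assumes "integrable \<mu> f"
  shows "integrable \<mu> (\<lambda>y. f (- y + x))"
proof -
  have [measurable]: "f \<in> borel_measurable \<mu>" using assms by simp
  show ?thesis
    using assms nn_integral_reflect[of "\<lambda>x. ennreal (norm (f x))" x]
    by (simp add: integrable_iff_bounded)
qed

lemma translation_continuous_L1:
  fixes f :: "'a \<Rightarrow> complex"
  assumes "integrable \<mu> f" and "(e::real) > 0"
  shows "\<exists>V. open V \<and> 0 \<in> V \<and> (\<forall>y\<in>V. (\<integral>\<^sup>+x. ennreal (norm (f (- y + x) - f x)) \<partial>\<mu>) \<le> ennreal e)"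
  using assms
proof (induction f arbitrary: e rule: integrable_induct)
  case (base A c)
  define d where "d = e / (norm c + 1)"
  have d: "d > 0" "norm c * d \<le> e"
    using base(3) by (auto simp: d_def field_simps add_pos_nonneg)
  obtain V where V: "open V" "0 \<in> V" "\<forall>y\<in>V. emeasure \<mu> {x. (- y + x \<in> A) \<noteq> (x \<in> A)} \<le> ennreal d"
    using translated_set_close[OF base(1,2) d(1)] by blast
  have [measurable]: "A \<in> sets \<mu>" by (rule base)
  have "(\<integral>\<^sup>+x. ennreal (norm (indicator A (- y + x) *\<^sub>R c - indicator A x *\<^sub>R c)) \<partial>\<mu>) \<le> ennreal e"
    if y: "y \<in> V" for y
  proof -
    let ?S = "{x. (- y + x \<in> A) \<noteq> (x \<in> A)}"
    have "?S = ((\<lambda>x. - y + x) -` A - A) \<union> (A - (\<lambda>x. - y + x) -` A)" by auto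
    moreover have "(\<lambda>x. - y + x) -` A \<in> sets \<mu>"
      using measurable_sets[OF measurable_trans(1) base(1), of "- y"] by simp
    ultimately have S: "?S \<in> sets \<mu>" using base(1) by auto
    have "(\<integral>\<^sup>+x. ennreal (norm (indicator A (- y + x) *\<^sub>R c - indicator A x *\<^sub>R c)) \<partial>\<mu>)
        = (\<integral>\<^sup>+x. ennreal (norm c) * indicator ?S x \<partial>\<mu>)"
      by (intro nn_integral_cong) (auto simp: indicator_def)
    also have "\<dots> = ennreal (norm c) * emeasure \<mu> ?S"
      using S by (rule nn_integral_cmult_indicator)
    also have "\<dots> \<le> ennreal (norm c) * ennreal d"
      using V(3) y by (intro mult_left_mono) auto
    also have "\<dots> \<le> ennreal e"
      using d by (simp add: ennreal_mult[symmetric] ennreal_leI)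
    finally show ?thesis .
  qed
  then show ?case using V(1,2) by blast
next
  case (add f g)
  have [measurable]: "f \<in> borel_measurable \<mu>" "g \<in> borel_measurable \<mu>" using add by auto
  have e2: "e / 2 > 0" using add by simp
  obtain V where V: "open V" "0 \<in> V" "\<forall>y\<in>V. (\<integral>\<^sup>+x. ennreal (norm (f (- y + x) - f x)) \<partial>\<mu>) \<le> ennreal (e / 2)"
    using add.IH(1)[OF e2] by blast
  obtain W where W: "open W" "0 \<in> W" "\<forall>y\<in>W. (\<integral>\<^sup>+x. ennreal (norm (g (- y + x) - g x)) \<partial>\<mu>) \<le> ennreal (e / 2)"
    using add.IH(2)[OF e2] by blast
  have "(\<integral>\<^sup>+x. ennreal (norm ((f (- y + x) + g (- y + x)) - (f x + g x))) \<partial>\<mu>) \<le> ennreal e"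
    if y: "y \<in> V \<inter> W" for y
  proof -
    have "(\<integral>\<^sup>+x. ennreal (norm ((f (- y + x) + g (- y + x)) - (f x + g x))) \<partial>\<mu>)
      \<le> (\<integral>\<^sup>+x. ennreal (norm (f (- y + x) - f x)) + ennreal (norm (g (- y + x) - g x)) \<partial>\<mu>)"
      by (intro nn_integral_mono)
        (simp add: ennreal_plus[symmetric] add_diff_add norm_triangle_ineq ennreal_leI del: ennreal_plus)
    also have "\<dots> = (\<integral>\<^sup>+x. ennreal (norm (f (- y + x) - f x)) \<partial>\<mu>) + (\<integral>\<^sup>+x. ennreal (norm (g (- y + x) - g x)) \<partial>\<mu>)"
      by (rule nn_integral_add) measurable
    also have "\<dots> \<le> ennreal (e / 2) + ennreal (e / 2)"
      using V(3) W(3) y by (intro add_mono) auto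
    also have "\<dots> = ennreal e"
      using e2 by (simp add: ennreal_plus[symmetric] del: ennreal_plus)
    finally show ?thesis .
  qed
  then show ?case using V(1,2) W(1,2) by (intro exI[of _ "V \<inter> W"]) auto
next
  case (lim f s)
  have [measurable]: "f \<in> borel_measurable \<mu>" "\<And>i. s i \<in> borel_measurable \<mu>" using lim by auto
  have "(\<lambda>i. \<integral>\<^sup>+x. norm (f x - s i x) \<partial>\<mu>) \<longlonglongrightarrow> 0"
  proof (rule nn_integral_dominated_convergence_norm[where w="\<lambda>x. 2 * norm (f x)"])
    show "(\<integral>\<^sup>+x. ennreal (2 * norm (f x)) \<partial>\<mu>) < \<infinity>"
      using lim(4) by (simp add: ennreal_mult nn_integral_cmult ennreal_mult_less_top integrable_iff_bounded)
  qed (use lim in auto)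
  moreover have e3: "e / 3 > 0" using lim by simp
  ultimately have "\<forall>\<^sub>F i in sequentially. (\<integral>\<^sup>+x. norm (f x - s i x) \<partial>\<mu>) < ennreal (e / 3)"
    by (intro order_tendstoD) auto
  then obtain i where i: "(\<integral>\<^sup>+x. norm (f x - s i x) \<partial>\<mu>) < ennreal (e / 3)"
    by (auto simp: eventually_sequentially)
  obtain V where V: "open V" "0 \<in> V"
      "\<forall>y\<in>V. (\<integral>\<^sup>+x. ennreal (norm (s i (- y + x) - s i x)) \<partial>\<mu>) \<le> ennreal (e / 3)"
    using lim.IH[OF e3, of i] by blast
  have "(\<integral>\<^sup>+x. ennreal (norm (f (- y + x) - f x)) \<partial>\<mu>) \<le> ennreal e" if y: "y \<in> V" for y
  proof -
    have tri: "norm (f (- y + x) - f x) \<le>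
        (norm (f (- y + x) - s i (- y + x)) + norm (s i (- y + x) - s i x)) + norm (f x - s i x)" for x
      using norm_triangle_ineq4[of "(f (- y + x) - s i (- y + x)) + (s i (- y + x) - s i x)" "f x - s i x"]
        norm_triangle_ineq[of "f (- y + x) - s i (- y + x)" "s i (- y + x) - s i x"] by simp
    have "(\<integral>\<^sup>+x. ennreal (norm (f (- y + x) - f x)) \<partial>\<mu>)
      \<le> (\<integral>\<^sup>+x. (ennreal (norm (f (- y + x) - s i (- y + x))) + ennreal (norm (s i (- y + x) - s i x)))
            + ennreal (norm (f x - s i x)) \<partial>\<mu>)"
      using tri by (intro nn_integral_mono) (simp add: ennreal_plus[symmetric] ennreal_leI del: ennreal_plus)
    also have "\<dots> = (\<integral>\<^sup>+x. ennreal (norm (f (- y + x) - s i (- y + x))) \<partial>\<mu>)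
        + (\<integral>\<^sup>+x. ennreal (norm (s i (- y + x) - s i x)) \<partial>\<mu>) + (\<integral>\<^sup>+x. ennreal (norm (f x - s i x)) \<partial>\<mu>)"
      by (simp add: nn_integral_add)
    also have "(\<integral>\<^sup>+x. ennreal (norm (f (- y + x) - s i (- y + x))) \<partial>\<mu>) = (\<integral>\<^sup>+x. ennreal (norm (f x - s i x)) \<partial>\<mu>)"
      by (rule nn_integral_ltrans[of "\<lambda>x. ennreal (norm (f x - s i x))"]) measurable
    also have "(\<integral>\<^sup>+x. ennreal (norm (f x - s i x)) \<partial>\<mu>) + (\<integral>\<^sup>+x. ennreal (norm (s i (- y + x) - s i x)) \<partial>\<mu>)
        + (\<integral>\<^sup>+x. ennreal (norm (f x - s i x)) \<partial>\<mu>) \<le> ennreal (e / 3) + ennreal (e / 3) + ennreal (e / 3)"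
      using V(3) y i by (intro add_mono) auto
    also have "\<dots> = ennreal e"
      using e3 by (simp add: ennreal_plus[symmetric] del: ennreal_plus)
    finally show ?thesis .
  qed
  then show ?case using V(1,2) by blast
qed

text \<open>
  Take $h$ to be the normalised indicator of a small neighbourhood $U$ of the identity. Then
  $h * g - g$ is the average over $y \in U$ of the differences between $g$ and its translate by
  $y$, each of which is small in $L^1$.
\<close>

lemma approximate_identity_diff_measurable:
  fixes g :: "'a \<Rightarrow> complex"
  assumes g: "integrable \<mu> g"
    and gd [measurable]: "(\<lambda>z. g (- fst z + snd z)) \<in> borel_measurable (\<mu> \<Otimes>\<^sub>M \<mu>)"
    and e: "(e::real) > 0"
  shows "\<exists>h. h \<in> borel_measurable \<mu> \<and> (\<integral>\<^sup>+y. ennreal (norm (h y)) \<partial>\<mu>) = 1 \<and>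
     (\<integral>\<^sup>+y. (ennreal (norm (h y)))\<^sup>2 \<partial>\<mu>) < \<infinity> \<and>
     (\<integral>\<^sup>+x. ennreal (norm (convolution \<mu> h g x - g x)) \<partial>\<mu>) \<le> ennreal e"
proof -
  obtain V where V: "open V" "0 \<in> V"
      "\<forall>y\<in>V. (\<integral>\<^sup>+x. ennreal (norm (g (- y + x) - g x)) \<partial>\<mu>) \<le> ennreal e"
    using translation_continuous_L1[OF g e] by blast
  obtain W :: "'a set" where W: "open W" "0 \<in> W" "emeasure \<mu> W < \<infinity>"
    using finite_neighbourhood by blast
  define U where "U = V \<inter> W"
  have U: "open U" "0 \<in> U" using V W by (auto simp: U_def)
  have [measurable]: "U \<in> sets \<mu>" "g \<in> borel_measurable \<mu>" using open_sets[OF U(1)] g by auto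
  have "emeasure \<mu> U \<le> emeasure \<mu> W" using W(1) open_sets by (intro emeasure_mono) (auto simp: U_def)
  then have Ufin: "emeasure \<mu> U < \<infinity>" using W(3) by (rule order.strict_trans1)
  define m where "m = measure \<mu> U"
  have em: "emeasure \<mu> U = ennreal m"
    unfolding m_def using Ufin by (intro emeasure_eq_ennreal_measure) auto
  have m: "m > 0" using open_pos[OF U] by (simp add: em)
  define h where "h y = complex_of_real (indicator U y / m)" for y
  have [measurable]: "h \<in> borel_measurable \<mu>" unfolding h_def by measurable
  have nh: "norm (h y) = indicator U y / m" for y
    using m by (simp add: h_def indicator_def norm_divide)
  have nh': "ennreal (norm (h y)) = ennreal (1 / m) * indicator U y" for y
    by (simp add: nh indicator_def)
  have "ennreal (1 / m) * ennreal m = 1"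
    using m by (simp add: ennreal_mult[symmetric])
  then have h1: "(\<integral>\<^sup>+y. ennreal (norm (h y)) \<partial>\<mu>) = 1"
    by (simp add: nh' nn_integral_cmult_indicator em)
  have "(\<integral>\<^sup>+y. (ennreal (norm (h y)))\<^sup>2 \<partial>\<mu>) = (\<integral>\<^sup>+y. (ennreal (1 / m))\<^sup>2 * indicator U y \<partial>\<mu>)"
    by (intro nn_integral_cong) (auto simp: nh' indicator_def)
  also have "\<dots> < \<infinity>"
    by (simp add: nn_integral_cmult_indicator em ennreal_mult_less_top power2_eq_square)
  finally have h2: "(\<integral>\<^sup>+y. (ennreal (norm (h y)))\<^sup>2 \<partial>\<mu>) < \<infinity>" .
  have hint: "integrable \<mu> h"
    using h1 by (simp add: integrable_iff_bounded)
  have "(\<integral>y. indicator U y / m \<partial>\<mu>) = (1::real)"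
    using m by (simp add: m_def[symmetric])
  then have h1': "(\<integral>y. h y \<partial>\<mu>) = 1"
    unfolding h_def by (subst integral_complex_of_real) simp
  have pt: "ennreal (norm (convolution \<mu> h g x - g x)) \<le> (\<integral>\<^sup>+y. ennreal (norm (h y)) * ennreal (norm (g (- y + x) - g x)) \<partial>\<mu>)"
    for x
  proof -
    have "integrable \<mu> (\<lambda>y. (1 / m) *\<^sub>R (indicator U y *\<^sub>R g (- y + x)))"
      by (intro integrable_scaleR_right integrable_mult_indicator integrable_reflect g) simp
    moreover have "(1 / m) *\<^sub>R (indicator U y *\<^sub>R g (- y + x)) = h y * g (- y + x)" for y
      by (simp add: h_def indicator_def scaleR_conv_of_real)
    ultimately have i1: "integrable \<mu> (\<lambda>y. h y * g (- y + x))" by simp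
    have i2: "integrable \<mu> (\<lambda>y. h y * g x)" using hint by simp
    have "convolution \<mu> h g x - g x = (\<integral>y. h y * g (- y + x) \<partial>\<mu>) - (\<integral>y. h y * g x \<partial>\<mu>)"
      by (simp add: convolution_def h1')
    also have "\<dots> = (\<integral>y. h y * g (- y + x) - h y * g x \<partial>\<mu>)"
      by (rule Bochner_Integration.integral_diff[symmetric, OF i1 i2])
    finally have "convolution \<mu> h g x - g x = (\<integral>y. h y * (g (- y + x) - g x) \<partial>\<mu>)"
      by (simp add: right_diff_distrib)
    moreover have "integrable \<mu> (\<lambda>y. h y * (g (- y + x) - g x))"
      using Bochner_Integration.integrable_diff[OF i1 i2] by (simp add: right_diff_distrib)
    ultimately show ?thesis
      using integral_norm_bound_ennreal[of \<mu> "\<lambda>y. h y * (g (- y + x) - g x)"]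
      by (simp add: norm_mult ennreal_mult)
  qed
  have "(\<integral>\<^sup>+x. ennreal (norm (convolution \<mu> h g x - g x)) \<partial>\<mu>)
      \<le> (\<integral>\<^sup>+x. \<integral>\<^sup>+y. ennreal (norm (h y)) * ennreal (norm (g (- y + x) - g x)) \<partial>\<mu> \<partial>\<mu>)"
    by (intro nn_integral_mono pt)
  also have "\<dots> = (\<integral>\<^sup>+y. \<integral>\<^sup>+x. ennreal (norm (h y)) * ennreal (norm (g (- y + x) - g x)) \<partial>\<mu> \<partial>\<mu>)"
    by (rule Fubini') (simp add: case_prod_beta)
  also have "\<dots> = (\<integral>\<^sup>+y. ennreal (norm (h y)) * (\<integral>\<^sup>+x. ennreal (norm (g (- y + x) - g x)) \<partial>\<mu>) \<partial>\<mu>)"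
    by (intro nn_integral_cong nn_integral_cmult) measurable
  also have "\<dots> \<le> (\<integral>\<^sup>+y. ennreal (norm (h y)) * ennreal e \<partial>\<mu>)"
  proof (intro nn_integral_mono)
    fix y
    show "ennreal (norm (h y)) * (\<integral>\<^sup>+x. ennreal (norm (g (- y + x) - g x)) \<partial>\<mu>) \<le> ennreal (norm (h y)) * ennreal e"
      using V(3) by (cases "y \<in> U") (auto simp: nh' U_def intro!: mult_left_mono)
  qed
  also have "\<dots> = ennreal e"
    by (simp add: nn_integral_multc h1)
  finally show ?thesis using h1 h2 by (intro exI[of _ h]) simp
qed

lemma approximate_identity:
  fixes f :: "'a \<Rightarrow> complex"
  assumes f: "integrable \<mu> f" and e: "(e::real) > 0"
  shows "\<exists>h. h \<in> borel_measurable \<mu> \<and> (\<integral>\<^sup>+y. ennreal (norm (h y)) \<partial>\<mu>) = 1 \<and>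
     (\<integral>\<^sup>+y. (ennreal (norm (h y)))\<^sup>2 \<partial>\<mu>) < \<infinity> \<and>
     (\<integral>\<^sup>+x. ennreal (norm (convolution \<mu> h f x - f x)) \<partial>\<mu>) \<le> ennreal e"
proof -
  have [measurable]: "f \<in> borel_measurable \<mu>" using f by simp
  obtain g where [measurable]: "g \<in> borel_measurable \<mu>"
      and gd: "(\<lambda>z. g (- fst z + snd z)) \<in> borel_measurable (\<mu> \<Otimes>\<^sub>M \<mu>)"
      and fg: "AE x in \<mu>. f x = g x"
    using complex_AE_diff_measurable[of f] by auto
  have "integrable \<mu> g" using integrable_cong_AE[OF _ _ fg] f by simp
  from approximate_identity_diff_measurable[OF this gd e]
  obtain h where h: "h \<in> borel_measurable \<mu>" "(\<integral>\<^sup>+y. ennreal (norm (h y)) \<partial>\<mu>) = 1"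
     "(\<integral>\<^sup>+y. (ennreal (norm (h y)))\<^sup>2 \<partial>\<mu>) < \<infinity>"
     "(\<integral>\<^sup>+x. ennreal (norm (convolution \<mu> h g x - g x)) \<partial>\<mu>) \<le> ennreal e" by blast
  have "convolution \<mu> h f = convolution \<mu> h g"
    using h(1) fg by (intro convolution_cong_AE) auto
  moreover have "(\<integral>\<^sup>+x. ennreal (norm (convolution \<mu> h g x - f x)) \<partial>\<mu>)
      = (\<integral>\<^sup>+x. ennreal (norm (convolution \<mu> h g x - g x)) \<partial>\<mu>)"
    by (rule nn_integral_cong_AE) (use fg in \<open>eventually_elim, simp\<close>)
  ultimately show ?thesis using h by (intro exI[of _ h]) simp
qed

text \<open>
  Errors $2^{-n}$ in $L^1$ are summable, which upgrades convergence in $L^1$ to convergence almost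
  everywhere.
\<close>

lemma approximate_identity_AE:
  fixes f :: "'a \<Rightarrow> complex"
  assumes f: "integrable \<mu> f"
  shows "\<exists>h. (\<forall>n::nat. h n \<in> borel_measurable \<mu> \<and> (\<integral>\<^sup>+y. ennreal (norm (h n y)) \<partial>\<mu>) = 1 \<and>
     (\<integral>\<^sup>+y. (ennreal (norm (h n y)))\<^sup>2 \<partial>\<mu>) < \<infinity>) \<and>
     (AE x in \<mu>. (\<lambda>n. convolution \<mu> (h n) f x) \<longlonglongrightarrow> f x)"
proof -
  have [measurable]: "f \<in> borel_measurable \<mu>" using f by simp
  have "\<exists>h. h \<in> borel_measurable \<mu> \<and> (\<integral>\<^sup>+y. ennreal (norm (h y)) \<partial>\<mu>) = 1 \<and>
     (\<integral>\<^sup>+y. (ennreal (norm (h y)))\<^sup>2 \<partial>\<mu>) < \<infinity> \<and>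
     (\<integral>\<^sup>+x. ennreal (norm (convolution \<mu> h f x - f x)) \<partial>\<mu>) \<le> ennreal ((1/2)^n)" for n :: nat
    by (rule approximate_identity[OF f]) simp
  then have "\<forall>n::nat. \<exists>h. h \<in> borel_measurable \<mu> \<and> (\<integral>\<^sup>+y. ennreal (norm (h y)) \<partial>\<mu>) = 1 \<and>
     (\<integral>\<^sup>+y. (ennreal (norm (h y)))\<^sup>2 \<partial>\<mu>) < \<infinity> \<and>
     (\<integral>\<^sup>+x. ennreal (norm (convolution \<mu> h f x - f x)) \<partial>\<mu>) \<le> ennreal ((1/2)^n)" ..
  from choice[OF this] obtain h where H: "\<forall>n::nat. h n \<in> borel_measurable \<mu> \<and>
     (\<integral>\<^sup>+y. ennreal (norm (h n y)) \<partial>\<mu>) = 1 \<and>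
     (\<integral>\<^sup>+y. (ennreal (norm (h n y)))\<^sup>2 \<partial>\<mu>) < \<infinity> \<and>
     (\<integral>\<^sup>+x. ennreal (norm (convolution \<mu> (h n) f x - f x)) \<partial>\<mu>) \<le> ennreal ((1/2)^n)" ..
  then have h: "h n \<in> borel_measurable \<mu>" "(\<integral>\<^sup>+y. ennreal (norm (h n y)) \<partial>\<mu>) = 1"
     "(\<integral>\<^sup>+y. (ennreal (norm (h n y)))\<^sup>2 \<partial>\<mu>) < \<infinity>"
     "(\<integral>\<^sup>+x. ennreal (norm (convolution \<mu> (h n) f x - f x)) \<partial>\<mu>) \<le> ennreal ((1/2)^n)" for n
    by simp_all
  note [measurable] = h(1)
  have "(\<integral>\<^sup>+x. (\<Sum>n. ennreal (norm (convolution \<mu> (h n) f x - f x))) \<partial>\<mu>)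
      = (\<Sum>n. \<integral>\<^sup>+x. ennreal (norm (convolution \<mu> (h n) f x - f x)) \<partial>\<mu>)"
    by (rule nn_integral_suminf) measurable
  also have "\<dots> \<le> (\<Sum>n. ennreal ((1/2)^n))"
    by (intro suminf_le h(4)) auto
  also have "\<dots> = ennreal (\<Sum>n. (1/2)^n)"
    by (intro suminf_ennreal2) (auto intro: summable_geometric)
  also have "\<dots> < \<infinity>" by simp
  finally have "AE x in \<mu>. (\<Sum>n. ennreal (norm (convolution \<mu> (h n) f x - f x))) \<noteq> \<infinity>"
    by (intro nn_integral_PInf_AE) auto
  then have "AE x in \<mu>. (\<lambda>n. convolution \<mu> (h n) f x) \<longlonglongrightarrow> f x"
  proof eventually_elim
    case (elim x)
    then have "summable (\<lambda>n. norm (convolution \<mu> (h n) f x - f x))"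
      by (intro summable_suminf_not_top) auto
    from summable_LIMSEQ_zero[OF this] show ?case
      by (rule LIM_zero_cancel[OF tendsto_norm_zero_cancel])
  qed
  then show ?thesis using h(1,2,3) by (intro exI[of _ h]) simp
qed

end

section \<open>Square integrable functions and their operators\<close>

text \<open>
  The square of the $L^2$ norm; it avoids the root hidden in \<open>lp_norm\<close>.
\<close>

definition l2sq :: "'b measure \<Rightarrow> ('b \<Rightarrow> complex) \<Rightarrow> ennreal" where
  "l2sq M h = (\<integral>\<^sup>+x. (ennreal (norm (h x)))\<^sup>2 \<partial>M)"

lemma lp_norm_2_square: "(lp_norm 2 M h)\<^sup>2 = l2sq M h"
proof -
  have "(\<integral>\<^sup>+x. ennreal (norm (h x) powr 2) \<partial>M) = l2sq M h"
    unfolding l2sq_def by (intro nn_integral_cong) (simp add: ennreal_power)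
  then have "lp_norm 2 M h = epowr (l2sq M h) (1 / 2)"
    by (simp add: lp_norm_def)
  moreover have "(epowr X (1 / 2))\<^sup>2 = X" for X
    by (cases X) (auto simp: epowr_def ennreal_power powr_half_sqrt top_power_ennreal)
  ultimately show ?thesis by simp
qed

lemma L2_iff: "h \<in> L2 M \<longleftrightarrow> h \<in> borel_measurable M \<and> l2sq M h < \<infinity>"
proof -
  have "lp_norm 2 M h < \<infinity> \<longleftrightarrow> (lp_norm 2 M h)\<^sup>2 < \<infinity>"
    by (cases "lp_norm 2 M h") (auto simp: ennreal_power top_power_ennreal)
  then show ?thesis by (simp add: L2_def lp_norm_2_square)
qed

lemma l2sq_cong_AE:
  assumes "AE x in M. h x = k x"
  shows "l2sq M h = l2sq M k"
  unfolding l2sq_def by (rule nn_integral_cong_AE) (use assms in \<open>eventually_elim, simp\<close>)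

lemma borel_measurable_cnj [measurable]:
  "f \<in> borel_measurable M \<Longrightarrow> (\<lambda>x. cnj (f x)) \<in> borel_measurable M"
  by (rule borel_measurable_continuous_on[of cnj]) (intro continuous_intros)

lemma L2_inner_integrable:
  assumes "h \<in> L2 M" "k \<in> L2 M"
  shows "integrable M (\<lambda>x. h x * cnj (k x))"
proof -
  have [measurable]: "h \<in> borel_measurable M" "k \<in> borel_measurable M" using assms by (auto simp: L2_iff)
  have "(\<integral>\<^sup>+x. ennreal (norm (h x)) * ennreal (norm (k x)) \<partial>M)\<^sup>2 \<le> l2sq M h * l2sq M k"
    unfolding l2sq_def by (rule Cauchy_Schwarz_nn_integral) auto
  also have "\<dots> < \<infinity>" using assms by (simp add: L2_iff ennreal_mult_less_top)
  finally have "(\<integral>\<^sup>+x. ennreal (norm (h x)) * ennreal (norm (k x)) \<partial>M) < \<infinity>"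
    by (auto simp: power2_eq_square ennreal_mult_less_top)
  then show ?thesis
    by (intro integrableI_bounded) (auto simp: norm_mult ennreal_mult)
qed

lemma L2_add:
  assumes "h \<in> L2 M" "k \<in> L2 M"
  shows "(\<lambda>x. h x + k x) \<in> L2 M"
proof -
  have [measurable]: "h \<in> borel_measurable M" "k \<in> borel_measurable M" using assms by (auto simp: L2_iff)
  have pt: "(norm (a + b))\<^sup>2 \<le> 2 * (norm a)\<^sup>2 + 2 * (norm b)\<^sup>2" for a b :: complex
  proof -
    have "(norm (a + b))\<^sup>2 \<le> (norm a + norm b)\<^sup>2"
      by (intro power_mono norm_triangle_ineq) simp
    also have "\<dots> \<le> 2 * (norm a)\<^sup>2 + 2 * (norm b)\<^sup>2"
      using sum_squares_bound[of "norm a" "norm b"] by (simp add: power2_sum)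
    finally show ?thesis .
  qed
  have "l2sq M (\<lambda>x. h x + k x) \<le> (\<integral>\<^sup>+x. 2 * (ennreal (norm (h x)))\<^sup>2 + 2 * (ennreal (norm (k x)))\<^sup>2 \<partial>M)"
    unfolding l2sq_def
  proof (intro nn_integral_mono)
    fix x
    have "(ennreal (norm (h x + k x)))\<^sup>2 \<le> ennreal (2 * (norm (h x))\<^sup>2 + 2 * (norm (k x))\<^sup>2)"
      using pt by (simp add: ennreal_power ennreal_leI del: ennreal_plus)
    then show "(ennreal (norm (h x + k x)))\<^sup>2 \<le> 2 * (ennreal (norm (h x)))\<^sup>2 + 2 * (ennreal (norm (k x)))\<^sup>2"
      by (simp add: ennreal_power ennreal_mult)
  qed
  also have "\<dots> = 2 * l2sq M h + 2 * l2sq M k"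
    by (simp add: l2sq_def nn_integral_add nn_integral_cmult)
  also have "\<dots> < \<infinity>" using assms by (simp add: L2_iff ennreal_mult_less_top)
  finally show ?thesis by (simp add: L2_iff)
qed

lemma L2_scale:
  assumes "h \<in> L2 M"
  shows "(\<lambda>x. c * h x) \<in> L2 M"
proof -
  have [measurable]: "h \<in> borel_measurable M" using assms by (auto simp: L2_iff)
  have "l2sq M (\<lambda>x. c * h x) = (ennreal (norm c))\<^sup>2 * l2sq M h"
    unfolding l2sq_def
    by (simp add: norm_mult ennreal_mult power_mult_distrib nn_integral_cmult)
  then show ?thesis using assms by (simp add: L2_iff ennreal_mult_less_top ennreal_power)
qed

lemma L2_diff:
  assumes "h \<in> L2 M" "k \<in> L2 M"
  shows "(\<lambda>x. h x - k x) \<in> L2 M"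
  using L2_add[OF assms(1) L2_scale[OF assms(2), of "-1"]] by simp

lemma l2_inner_diff_left:
  assumes "h \<in> L2 M" "k \<in> L2 M" "s \<in> L2 M"
  shows "l2_inner M (\<lambda>x. h x - k x) s = l2_inner M h s - l2_inner M k s"
  using L2_inner_integrable[OF assms(1,3)] L2_inner_integrable[OF assms(2,3)]
  by (simp add: l2_inner_def left_diff_distrib)

lemma l2_inner_cnj: "l2_inner M k h = cnj (l2_inner M h k)"
proof -
  have "cnj (l2_inner M h k) = (\<integral>x. cnj (h x * cnj (k x)) \<partial>M)"
    unfolding l2_inner_def by (rule Bochner_Integration.integral_cnj[symmetric])
  then show ?thesis by (simp add: l2_inner_def mult.commute)
qed

lemma l2_inner_cong_AE:
  assumes "h \<in> L2 M" "h' \<in> L2 M" "k \<in> L2 M" "AE x in M. h x = h' x"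
  shows "l2_inner M h k = l2_inner M h' k"
proof -
  have [measurable]: "h \<in> borel_measurable M" "h' \<in> borel_measurable M" "k \<in> borel_measurable M"
    using assms by (auto simp: L2_iff)
  show ?thesis
    unfolding l2_inner_def
  proof (rule integral_cong_AE)
    show "AE x in M. h x * cnj (k x) = h' x * cnj (k x)"
      using assms(4) by eventually_elim simp
  qed measurable
qed

lemma l2_inner_self:
  assumes "h \<in> L2 M"
  shows "l2_inner M h h = of_real (enn2real (l2sq M h))"
proof -
  have [measurable]: "h \<in> borel_measurable M" using assms by (auto simp: L2_iff)
  have "l2_inner M h h = (\<integral>x. complex_of_real ((norm (h x))\<^sup>2) \<partial>M)"
    unfolding l2_inner_def by (simp only: complex_norm_square)
  also have "\<dots> = complex_of_real (\<integral>x. (norm (h x))\<^sup>2 \<partial>M)" by (rule integral_complex_of_real)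
  also have "(\<integral>x. (norm (h x))\<^sup>2 \<partial>M) = enn2real (\<integral>\<^sup>+x. ennreal ((norm (h x))\<^sup>2) \<partial>M)"
    by (rule integral_eq_nn_integral) auto
  finally show ?thesis by (simp add: l2sq_def ennreal_power)
qed

lemma l2_inner_self_zero:
  assumes "h \<in> L2 M" "l2_inner M h h = 0"
  shows "AE x in M. h x = 0"
proof -
  have [measurable]: "h \<in> borel_measurable M" using assms by (auto simp: L2_iff)
  have "l2sq M h = 0"
    using assms l2_inner_self[OF assms(1)] by (auto simp: enn2real_eq_0_iff L2_iff)
  then have "AE x in M. (ennreal (norm (h x)))\<^sup>2 = 0"
    unfolding l2sq_def by (subst (asm) nn_integral_0_iff_AE) auto
  then show ?thesis by eventually_elim (simp add: ennreal_power)
qed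

text \<open>
  Polarization: positivity makes the quadratic form $\langle Bw, w \rangle$ real. Comparing its
  values at $w = u + v$ and at $w = u + iv$ shows that
  $\langle Bu, v \rangle$ and $\langle Bv, u \rangle$ are conjugate.
\<close>

lemma positive_op_selfadjoint:
  assumes B: "positive_op M B" and u: "u \<in> L2 M" and v: "v \<in> L2 M"
  shows "l2_inner M (B u) v = l2_inner M u (B v)"
proof -
  have bdd: "bounded_op M B" and pos: "\<And>h. h \<in> L2 M \<Longrightarrow> l2_inner M (B h) h \<in> \<real>\<^sub>\<ge>\<^sub>0"
    using B by (auto simp: positive_op_def)
  have L: "\<And>h. h \<in> L2 M \<Longrightarrow> B h \<in> L2 M"
    and add: "\<And>h k. h \<in> L2 M \<Longrightarrow> k \<in> L2 M \<Longrightarrow> AE x in M. B (\<lambda>y. h y + k y) x = B h x + B k x"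
    and scale: "\<And>c h. h \<in> L2 M \<Longrightarrow> AE x in M. B (\<lambda>y. c * h y) x = c * B h x"
    using bdd unfolding bounded_op_def by blast+
  have expand: "l2_inner M (B (\<lambda>y. u y + c * v y)) (\<lambda>y. u y + c * v y) =
      l2_inner M (B u) u + cnj c * l2_inner M (B u) v + c * l2_inner M (B v) u + c * cnj c * l2_inner M (B v) v" for c
  proof -
    have w: "(\<lambda>y. u y + c * v y) \<in> L2 M" by (intro L2_add L2_scale u v)
    have "AE x in M. B (\<lambda>y. u y + c * v y) x = B u x + c * B v x"
      using add[OF u L2_scale[OF v, of c]] scale[OF v, of c] by eventually_elim simp
    then have "l2_inner M (B (\<lambda>y. u y + c * v y)) (\<lambda>y. u y + c * v y) =
        l2_inner M (\<lambda>x. B u x + c * B v x) (\<lambda>y. u y + c * v y)"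
      by (intro l2_inner_cong_AE L w L2_add L2_scale u v)
    also have "\<dots> = (\<integral>x. ((B u x * cnj (u x) + cnj c * (B u x * cnj (v x))) + c * (B v x * cnj (u x)))
        + (c * cnj c) * (B v x * cnj (v x)) \<partial>M)"
      unfolding l2_inner_def by (intro Bochner_Integration.integral_cong) (auto simp: algebra_simps)
    also have "\<dots> = l2_inner M (B u) u + cnj c * l2_inner M (B u) v + c * l2_inner M (B v) u
        + c * cnj c * l2_inner M (B v) v"
      unfolding l2_inner_def
      by (subst Bochner_Integration.integral_add,
          (intro Bochner_Integration.integrable_add integrable_mult_right L2_inner_integrable L u v)+)+
        (simp only: integral_mult_right_zero)
    finally show ?thesis .
  qed
  have im: "Im (l2_inner M (B h) h) = 0" if "h \<in> L2 M" for h
    using pos[OF that] by (auto simp: nonneg_Reals_def)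
  have w: "(\<lambda>y. u y + c * v y) \<in> L2 M" for c by (intro L2_add L2_scale u v)
  have "Im (l2_inner M (B u) v) + Im (l2_inner M (B v) u) = 0"
    using im[OF w[of 1]] im[OF u] im[OF v] unfolding expand by simp
  moreover have "Re (l2_inner M (B u) v) = Re (l2_inner M (B v) u)"
    using im[OF w[of \<i>]] im[OF u] im[OF v] unfolding expand by simp
  ultimately have "l2_inner M (B u) v = cnj (l2_inner M (B v) u)"
    by (simp add: complex_eq_iff)
  then show ?thesis using l2_inner_cnj[of M u "B v"] by simp
qed

text \<open>
  $\|Ph\|^2 = \langle Ph, h \rangle = \langle B^2 h, h \rangle = \|Bh\|^2$. The outer
  equalities are the orthogonality of $h - Ph$ to $Ph$ and the selfadjointness of $B$.
\<close>

lemma projector_norm_eq_sqrt_norm: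
  assumes P: "is_orth_projector M S P" and S: "S \<subseteq> L2 M"
    and B: "is_sqrt_op M P B" and h: "h \<in> L2 M"
  shows "l2sq M (P h) = l2sq M (B h)"
proof -
  have PS: "P h \<in> S" and orth: "\<And>s. s \<in> S \<Longrightarrow> l2_inner M (\<lambda>x. h x - P h x) s = 0"
    using P h by (auto simp: is_orth_projector_def)
  have Ph: "P h \<in> L2 M" using PS S by blast
  have pos: "positive_op M B" and BB: "AE x in M. B (B h) x = P h x"
    using B h by (auto simp: is_sqrt_op_def op_eq_def)
  have Bh: "B h \<in> L2 M" and BBh: "B (B h) \<in> L2 M"
    using pos h by (auto simp: positive_op_def bounded_op_def)
  have "l2_inner M (P h) (P h) = l2_inner M h (P h)"
    using orth[OF PS] l2_inner_diff_left[OF h Ph Ph] by simp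
  also have "\<dots> = cnj (l2_inner M (P h) h)" by (rule l2_inner_cnj)
  also have "l2_inner M (P h) h = l2_inner M (B (B h)) h"
    by (intro l2_inner_cong_AE Ph BBh h) (use BB in \<open>eventually_elim, simp\<close>)
  also have "\<dots> = l2_inner M (B h) (B h)"
    by (rule positive_op_selfadjoint[OF pos Bh h])
  finally have "enn2real (l2sq M (P h)) = enn2real (l2sq M (B h))"
    using l2_inner_self[OF Ph] l2_inner_self[OF Bh] by simp
  then show ?thesis
    using Ph Bh by (metis L2_iff ennreal_enn2real infinity_ennreal_def)
qed

section \<open>Right convolution operators and the support projector\<close>

context separable_unimodular_group
begin

lemma l2sq_convolution_le:
  assumes [measurable]: "h \<in> borel_measurable \<mu>" "f \<in> borel_measurable \<mu>"
  shows "l2sq \<mu> (convolution \<mu> h f) \<le> l2sq \<mu> h * (\<integral>\<^sup>+x. ennreal (norm (f x)) \<partial>\<mu>)\<^sup>2"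
    and "l2sq \<mu> (convolution \<mu> h f) \<le> (\<integral>\<^sup>+x. ennreal (norm (h x)) \<partial>\<mu>)\<^sup>2 * l2sq \<mu> f"
    and "(ennreal (norm (convolution \<mu> h f x)))\<^sup>2 \<le> l2sq \<mu> h * l2sq \<mu> f"
proof -
  let ?T = "nn_conv (\<lambda>y. ennreal (norm (h y))) (\<lambda>y. ennreal (norm (f y)))"
  have *: "(ennreal (norm (convolution \<mu> h f x)))\<^sup>2 \<le> (?T x)\<^sup>2" for x
    by (intro power_mono norm_convolution_le) simp
  then have **: "l2sq \<mu> (convolution \<mu> h f) \<le> (\<integral>\<^sup>+x. (?T x)\<^sup>2 \<partial>\<mu>)"
    unfolding l2sq_def by (intro nn_integral_mono)
  show "l2sq \<mu> (convolution \<mu> h f) \<le> l2sq \<mu> h * (\<integral>\<^sup>+x. ennreal (norm (f x)) \<partial>\<mu>)\<^sup>2"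
    by (rule order.trans[OF **]) (auto simp: l2sq_def intro!: Young_L2_L1)
  show "l2sq \<mu> (convolution \<mu> h f) \<le> (\<integral>\<^sup>+x. ennreal (norm (h x)) \<partial>\<mu>)\<^sup>2 * l2sq \<mu> f"
    by (rule order.trans[OF **]) (auto simp: l2sq_def intro!: Young_L1_L2)
  show "(ennreal (norm (convolution \<mu> h f x)))\<^sup>2 \<le> l2sq \<mu> h * l2sq \<mu> f"
    by (rule order.trans[OF *]) (auto simp: l2sq_def intro!: Young_L2_L2)
qed

lemma nn_conv_finite:
  fixes f :: "'a \<Rightarrow> complex"
  assumes h: "h \<in> L2 \<mu>" and f: "integrable \<mu> f"
  shows "(\<integral>\<^sup>+x. (nn_conv (\<lambda>y. ennreal (norm (h y))) (\<lambda>y. ennreal (norm (f y))) x)\<^sup>2 \<partial>\<mu>) < \<infinity>"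
proof -
  have [measurable]: "h \<in> borel_measurable \<mu>" "f \<in> borel_measurable \<mu>" using h f by (auto simp: L2_iff)
  have "(\<integral>\<^sup>+x. (nn_conv (\<lambda>y. ennreal (norm (h y))) (\<lambda>y. ennreal (norm (f y))) x)\<^sup>2 \<partial>\<mu>)
      \<le> l2sq \<mu> h * (\<integral>\<^sup>+x. ennreal (norm (f x)) \<partial>\<mu>)\<^sup>2"
    unfolding l2sq_def by (rule Young_L2_L1) auto
  also have "\<dots> < \<infinity>"
    using h f by (simp add: L2_iff integrable_iff_bounded ennreal_mult_less_top power2_eq_square)
  finally show ?thesis .
qed

lemma convolution_L2:
  assumes h: "h \<in> L2 \<mu>" and f: "integrable \<mu> f"
  shows "convolution \<mu> h f \<in> L2 \<mu>"
proof -
  have [measurable]: "h \<in> borel_measurable \<mu>" "f \<in> borel_measurable \<mu>" using h f by (auto simp: L2_iff)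
  have "l2sq \<mu> h * (\<integral>\<^sup>+x. ennreal (norm (f x)) \<partial>\<mu>)\<^sup>2 < \<infinity>"
    using h f by (simp add: L2_iff integrable_iff_bounded ennreal_mult_less_top power2_eq_square)
  with l2sq_convolution_le(1)[of h f] show ?thesis by (auto simp: L2_iff)
qed

lemma AE_convolution_integrable:
  assumes h: "h \<in> L2 \<mu>" and f: "integrable \<mu> f"
  shows "AE x in \<mu>. integrable \<mu> (\<lambda>y. h y * f (- y + x))"
proof -
  have [measurable]: "h \<in> borel_measurable \<mu>" "f \<in> borel_measurable \<mu>" using h f by (auto simp: L2_iff)
  have "AE x in \<mu>. (nn_conv (\<lambda>y. ennreal (norm (h y))) (\<lambda>y. ennreal (norm (f y))) x)\<^sup>2 \<noteq> \<infinity>"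
    using nn_conv_finite[OF h f] by (intro nn_integral_PInf_AE) auto
  then show ?thesis
  proof eventually_elim
    case (elim x)
    then have "nn_conv (\<lambda>y. ennreal (norm (h y))) (\<lambda>y. ennreal (norm (f y))) x < \<infinity>"
      by (auto simp: less_top[symmetric] power2_eq_square ennreal_mult_eq_top_iff)
    then show ?case
      by (intro integrableI_bounded) (auto simp: nn_conv_def norm_mult ennreal_mult)
  qed
qed

text \<open>
  The function $f^*$ whose right convolution operator is, on a unimodular group, the adjoint of that
  of $f$.
\<close>

definition involution :: "('a \<Rightarrow> complex) \<Rightarrow> 'a \<Rightarrow> complex" where
  "involution f x = cnj (f (- x))"

lemma integrable_involution:
  assumes "integrable \<mu> f"
  shows "integrable \<mu> (involution f)"
  using integrable_reflect[OF assms, of 0] unfolding involution_def by simp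

text \<open>
  Fubini's theorem for $u(y)\, f(y^{-1} x)\, \overline{k(x)}$. It is absolutely integrable, since
  $|u| * |f|$ is square integrable by Young's inequality and $k$ is.
\<close>

lemma convolution_adjoint:
  assumes u: "u \<in> L2 \<mu>" and k: "k \<in> L2 \<mu>" and f: "integrable \<mu> f"
  shows "l2_inner \<mu> (convolution \<mu> u f) k = l2_inner \<mu> u (convolution \<mu> k (involution f))"
proof -
  have [measurable]: "u \<in> borel_measurable \<mu>" "k \<in> borel_measurable \<mu>" "f \<in> borel_measurable \<mu>"
    using u k f by (auto simp: L2_iff)
  obtain g where [measurable]: "g \<in> borel_measurable \<mu>"
      and [measurable]: "(\<lambda>z. g (- fst z + snd z)) \<in> borel_measurable (\<mu> \<Otimes>\<^sub>M \<mu>)"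
      and fg: "AE x in \<mu>. f x = g x"
    using complex_AE_diff_measurable[of f] by auto
  have g: "integrable \<mu> g" using integrable_cong_AE[OF _ _ fg] f by simp
  have [measurable]: "involution f \<in> borel_measurable \<mu>" "involution g \<in> borel_measurable \<mu>"
    using integrable_involution[OF f] integrable_involution[OF g] by auto
  have "AE x in \<mu>. involution f x = involution g x"
    using AE_reflect[OF fg, of 0] by (simp add: involution_def)
  then have cong: "convolution \<mu> u f = convolution \<mu> u g"
      "convolution \<mu> k (involution f) = convolution \<mu> k (involution g)"
    using fg by (auto intro!: convolution_cong_AE)
  let ?F = "\<lambda>y x. u y * g (- y + x) * cnj (k x)"
  let ?T = "nn_conv (\<lambda>y. ennreal (norm (u y))) (\<lambda>y. ennreal (norm (g y)))"
  have "integrable (\<mu> \<Otimes>\<^sub>M \<mu>) (case_prod ?F)"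
  proof (rule integrableI_bounded)
    have "(\<integral>\<^sup>+z. ennreal (norm (case_prod ?F z)) \<partial>(\<mu> \<Otimes>\<^sub>M \<mu>)) =
        (\<integral>\<^sup>+x. \<integral>\<^sup>+y. ennreal (norm (?F y x)) \<partial>\<mu> \<partial>\<mu>)"
      by (subst nn_integral_snd[symmetric]) (simp_all add: case_prod_beta)
    also have "\<dots> = (\<integral>\<^sup>+x. ?T x * ennreal (norm (k x)) \<partial>\<mu>)"
      by (intro nn_integral_cong) (simp add: nn_conv_def norm_mult ennreal_mult nn_integral_multc)
    finally have eq: "(\<integral>\<^sup>+z. ennreal (norm (case_prod ?F z)) \<partial>(\<mu> \<Otimes>\<^sub>M \<mu>)) =
        (\<integral>\<^sup>+x. ?T x * ennreal (norm (k x)) \<partial>\<mu>)" .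
    have "(\<integral>\<^sup>+x. ?T x * ennreal (norm (k x)) \<partial>\<mu>)\<^sup>2 \<le> (\<integral>\<^sup>+x. (?T x)\<^sup>2 \<partial>\<mu>) * l2sq \<mu> k"
      unfolding l2sq_def by (rule Cauchy_Schwarz_nn_integral) auto
    also have "\<dots> < \<infinity>"
      using nn_conv_finite[OF u g] k by (simp add: L2_iff ennreal_mult_less_top)
    finally show "(\<integral>\<^sup>+z. ennreal (norm (case_prod ?F z)) \<partial>(\<mu> \<Otimes>\<^sub>M \<mu>)) < \<infinity>"
      unfolding eq by (auto simp: power2_eq_square ennreal_mult_less_top)
  qed (simp add: case_prod_beta)
  then have fub: "(\<integral>x. (\<integral>y. ?F y x \<partial>\<mu>) \<partial>\<mu>) = (\<integral>y. (\<integral>x. ?F y x \<partial>\<mu>) \<partial>\<mu>)"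
    by (rule Fubini_integral)
  have "l2_inner \<mu> (convolution \<mu> u g) k = (\<integral>x. (\<integral>y. ?F y x \<partial>\<mu>) \<partial>\<mu>)"
    by (simp add: l2_inner_def convolution_def)
  also have "\<dots> = (\<integral>y. (\<integral>x. ?F y x \<partial>\<mu>) \<partial>\<mu>)" by (rule fub)
  also have "\<dots> = (\<integral>y. u y * (\<integral>x. cnj (k x * involution g (- x + y)) \<partial>\<mu>) \<partial>\<mu>)"
    by (simp add: involution_def minus_add mult_ac del: Bochner_Integration.integral_cnj integral_mult_right_zero flip: integral_mult_right_zero)
  also have "\<dots> = l2_inner \<mu> u (convolution \<mu> k (involution g))"
    by (simp only: l2_inner_def convolution_def Bochner_Integration.integral_cnj)
  finally show ?thesis by (simp add: cong)
qed

text \<open>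
  With $d = h - Ph$ and $k = d * f$, the function $k * f^*$ is orthogonal to the kernel of $R_f$
  and therefore lies in its support. Hence
  $\|k\|^2 = \langle d * f, k \rangle = \langle d, k * f^* \rangle = 0$.
\<close>

lemma convolution_projector:
  assumes f: "integrable \<mu> f" and P: "is_orth_projector \<mu> (supp_R \<mu> f) P" and h: "h \<in> L2 \<mu>"
  shows "AE x in \<mu>. convolution \<mu> h f x = convolution \<mu> (P h) f x"
proof -
  have PS: "P h \<in> supp_R \<mu> f" and orth: "\<And>s. s \<in> supp_R \<mu> f \<Longrightarrow> l2_inner \<mu> (\<lambda>x. h x - P h x) s = 0"
    using P h by (auto simp: is_orth_projector_def)
  have Ph: "P h \<in> L2 \<mu>" using PS by (simp add: supp_R_def ortho_complement_def)
  define d where "d = (\<lambda>x. h x - P h x)"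
  have d: "d \<in> L2 \<mu>" unfolding d_def by (intro L2_diff h Ph)
  define k where "k = convolution \<mu> d f"
  have k: "k \<in> L2 \<mu>" unfolding k_def by (intro convolution_L2 d f)
  have s: "convolution \<mu> k (involution f) \<in> L2 \<mu>"
    by (intro convolution_L2 k integrable_involution f)
  have "convolution \<mu> k (involution f) \<in> supp_R \<mu> f"
    unfolding supp_R_def ortho_complement_def
  proof (intro CollectI conjI s ballI)
    fix w assume "w \<in> op_kernel \<mu> (right_fourier \<mu> f)"
    then have w: "w \<in> L2 \<mu>" "AE x in \<mu>. convolution \<mu> w f x = 0"
      by (auto simp: op_kernel_def right_fourier_def)
    have "l2_inner \<mu> w (convolution \<mu> k (involution f)) = l2_inner \<mu> (convolution \<mu> w f) k"
      by (rule convolution_adjoint[symmetric, OF w(1) k f])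
    also have "\<dots> = 0"
      unfolding l2_inner_def by (rule integral_eq_zero_AE) (use w(2) in \<open>eventually_elim, simp\<close>)
    finally show "l2_inner \<mu> (convolution \<mu> k (involution f)) w = 0"
      using l2_inner_cnj[of \<mu> "convolution \<mu> k (involution f)" w] by simp
  qed
  \<comment> \<open>\<open>h - P h\<close> is orthogonal to the support, in particular to \<open>k * f\<^sup>*\<close>; move the operator to the left.\<close>
  from orth[OF this] have "l2_inner \<mu> k k = 0"
    using convolution_adjoint[OF d k f] by (simp add: d_def k_def)
  then have "AE x in \<mu>. convolution \<mu> d f x = 0"
    using l2_inner_self_zero[OF k] by (simp add: k_def)
  with AE_convolution_integrable[OF h f] AE_convolution_integrable[OF Ph f]
  show ?thesis
  proof eventually_elim
    case (elim x)
    then show ?case by (simp add: convolution_def d_def left_diff_distrib)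
  qed
qed

text \<open>
  For $h \in L^2$ with $\|h\|_1 = 1$ the function $h * f = (Ph) * f$ obeys Young's inequality with
  $\|Ph\|_2 = \|h * K\|_2 \le \|K\|_2$, so the bounds do not depend on $h$ and survive the
  limit along an approximate identity. The first claim gives the second its content,
  since integrability of $f$ alone does not make its $L^2$ norm finite.
\<close>

lemma finite_trace_bounds:
  assumes f: "integrable \<mu> f" and P: "is_orth_projector \<mu> (supp_R \<mu> f) P"
    and tr: "vn_trace \<mu> P < \<infinity>"
  shows "l2sq \<mu> f < \<infinity>"
    and "AE x in \<mu>. (ennreal (norm (f x)))\<^sup>2 \<le> vn_trace \<mu> P * l2sq \<mu> f"
proof -
  have [measurable]: "f \<in> borel_measurable \<mu>" using f by simp
  define K where "K = (SOME K. \<exists>B. is_sqrt_op \<mu> P B \<and> is_L2_kernel \<mu> B K)"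
  have "\<exists>K B. is_sqrt_op \<mu> P B \<and> is_L2_kernel \<mu> B K" and trK: "vn_trace \<mu> P = l2sq \<mu> K"
    using tr by (auto simp: vn_trace_def K_def lp_norm_2_square split: if_splits)
  from someI_ex[OF this(1)] obtain B where B: "is_sqrt_op \<mu> P B" "is_L2_kernel \<mu> B K"
    unfolding K_def by blast
  have K: "K \<in> L2 \<mu>" using B(2) by (simp add: is_L2_kernel_def)
  then have [measurable]: "K \<in> borel_measurable \<mu>" by (simp add: L2_iff)
  have SL: "supp_R \<mu> f \<subseteq> L2 \<mu>" by (auto simp: supp_R_def ortho_complement_def)
  have bound: "AE x in \<mu>. (ennreal (norm (convolution \<mu> h f x)))\<^sup>2 \<le> vn_trace \<mu> P * l2sq \<mu> f"
    "l2sq \<mu> (convolution \<mu> h f) \<le> vn_trace \<mu> P * (\<integral>\<^sup>+x. ennreal (norm (f x)) \<partial>\<mu>)\<^sup>2"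
    if h: "h \<in> L2 \<mu>" and h1: "(\<integral>\<^sup>+x. ennreal (norm (h x)) \<partial>\<mu>) = 1" for h
  proof -
    have Ph: "P h \<in> L2 \<mu>" using P h SL by (auto simp: is_orth_projector_def)
    have [measurable]: "h \<in> borel_measurable \<mu>" "P h \<in> borel_measurable \<mu>" using h Ph by (auto simp: L2_iff)
    have "l2sq \<mu> (P h) = l2sq \<mu> (B h)"
      by (rule projector_norm_eq_sqrt_norm[OF P SL B(1) h])
    also have "\<dots> = l2sq \<mu> (convolution \<mu> h K)"
      using B(2) h by (intro l2sq_cong_AE) (simp add: is_L2_kernel_def op_eq_def)
    also have "\<dots> \<le> vn_trace \<mu> P"
      using l2sq_convolution_le(2)[of h K] h1 by (simp add: trK)
    finally have le: "l2sq \<mu> (P h) \<le> vn_trace \<mu> P" .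
    have eq: "AE x in \<mu>. convolution \<mu> h f x = convolution \<mu> (P h) f x"
      by (rule convolution_projector[OF f P h])
    have *: "(ennreal (norm (convolution \<mu> (P h) f x)))\<^sup>2 \<le> vn_trace \<mu> P * l2sq \<mu> f" for x
      using l2sq_convolution_le(3)[of "P h" f x] mult_right_mono[OF le, of "l2sq \<mu> f"] by simp
    from eq show "AE x in \<mu>. (ennreal (norm (convolution \<mu> h f x)))\<^sup>2 \<le> vn_trace \<mu> P * l2sq \<mu> f"
      by eventually_elim (simp add: *)
    have "l2sq \<mu> (convolution \<mu> h f) = l2sq \<mu> (convolution \<mu> (P h) f)"
      by (rule l2sq_cong_AE[OF eq])
    then show "l2sq \<mu> (convolution \<mu> h f) \<le> vn_trace \<mu> P * (\<integral>\<^sup>+x. ennreal (norm (f x)) \<partial>\<mu>)\<^sup>2"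
      using l2sq_convolution_le(1)[of "P h" f] mult_right_mono[OF le, of "(\<integral>\<^sup>+x. ennreal (norm (f x)) \<partial>\<mu>)\<^sup>2"]
      by simp
  qed
  obtain h where h: "\<And>n::nat. h n \<in> borel_measurable \<mu>" "\<And>n. (\<integral>\<^sup>+y. ennreal (norm (h n y)) \<partial>\<mu>) = 1"
      "\<And>n. (\<integral>\<^sup>+y. (ennreal (norm (h n y)))\<^sup>2 \<partial>\<mu>) < \<infinity>"
    and lim: "AE x in \<mu>. (\<lambda>n. convolution \<mu> (h n) f x) \<longlonglongrightarrow> f x"
    using approximate_identity_AE[OF f] by blast
  have hL: "h n \<in> L2 \<mu>" for n using h by (simp add: L2_iff l2sq_def)
  note [measurable] = h(1)
  have lim2: "AE x in \<mu>. (\<lambda>n. (ennreal (norm (convolution \<mu> (h n) f x)))\<^sup>2) \<longlonglongrightarrow> (ennreal (norm (f x)))\<^sup>2"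
    using lim by eventually_elim (simp add: ennreal_power, intro tendsto_ennrealI tendsto_intros)
  have "l2sq \<mu> f = (\<integral>\<^sup>+x. liminf (\<lambda>n. (ennreal (norm (convolution \<mu> (h n) f x)))\<^sup>2) \<partial>\<mu>)"
    unfolding l2sq_def
    by (rule nn_integral_cong_AE) (use lim2 in \<open>eventually_elim, simp add: lim_imp_Liminf\<close>)
  also have "\<dots> \<le> liminf (\<lambda>n. l2sq \<mu> (convolution \<mu> (h n) f))"
    unfolding l2sq_def by (rule nn_integral_liminf) measurable
  also have "\<dots> \<le> liminf (\<lambda>n::nat. vn_trace \<mu> P * (\<integral>\<^sup>+x. ennreal (norm (f x)) \<partial>\<mu>)\<^sup>2)"
    using bound(2)[OF hL h(2)] by (intro Liminf_mono always_eventually allI)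
  also have "\<dots> = vn_trace \<mu> P * (\<integral>\<^sup>+x. ennreal (norm (f x)) \<partial>\<mu>)\<^sup>2"
    by (rule Liminf_const) simp
  also have "\<dots> < \<infinity>"
    using tr f by (simp add: integrable_iff_bounded ennreal_mult_less_top power2_eq_square)
  finally show "l2sq \<mu> f < \<infinity>" .
  have "AE x in \<mu>. \<forall>n. (ennreal (norm (convolution \<mu> (h n) f x)))\<^sup>2 \<le> vn_trace \<mu> P * l2sq \<mu> f"
    using bound(1)[OF hL h(2)] by (simp add: AE_all_countable)
  with lim2 show "AE x in \<mu>. (ennreal (norm (f x)))\<^sup>2 \<le> vn_trace \<mu> P * l2sq \<mu> f"
    by eventually_elim (rule LIMSEQ_le_const2, auto)
qed

end

section \<open>Interpolation between the exponents\<close>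

lemma nn_integral_powr_le:
  fixes f :: "'b \<Rightarrow> complex"
  assumes [measurable]: "f \<in> borel_measurable M"
    and bound: "AE x in M. norm (f x) \<le> s" and ab: "0 < a" "a \<le> b"
  shows "(\<integral>\<^sup>+x. ennreal (norm (f x) powr b) \<partial>M) \<le> ennreal (s powr (b - a)) * (\<integral>\<^sup>+x. ennreal (norm (f x) powr a) \<partial>M)"
proof -
  have "AE x in M. ennreal (norm (f x) powr b) \<le> ennreal (s powr (b - a)) * ennreal (norm (f x) powr a)"
    using bound
  proof eventually_elim
    case (elim x)
    have "norm (f x) powr b = norm (f x) powr (b - a) * norm (f x) powr a"
      by (simp add: powr_add[symmetric])
    also have "\<dots> \<le> s powr (b - a) * norm (f x) powr a"
      using elim ab by (intro mult_right_mono powr_mono2) auto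
    finally show ?case by (simp add: ennreal_mult[symmetric] ennreal_leI)
  qed
  then have "(\<integral>\<^sup>+x. ennreal (norm (f x) powr b) \<partial>M) \<le> (\<integral>\<^sup>+x. ennreal (s powr (b - a)) * ennreal (norm (f x) powr a) \<partial>M)"
    by (rule nn_integral_mono_AE)
  then show ?thesis by (simp add: nn_integral_cmult)
qed

lemma lp_norm_AE_zero:
  fixes f :: "'b \<Rightarrow> complex"
  assumes [measurable]: "f \<in> borel_measurable M" and 0: "AE x in M. f x = 0" and q: "0 < q"
  shows "lp_norm q M f = 0"
proof (cases "q = \<infinity>")
  case True
  have "AE x in M. ennreal (norm (f x)) \<le> 0"
    using 0 by eventually_elim simp
  then have "esssup M (\<lambda>x. ennreal (norm (f x))) \<le> 0"
    by (intro esssup_I) auto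
  then show ?thesis using True by (simp add: lp_norm_def)
next
  case False
  then have "enn2real q > 0" using q by (simp add: enn2real_positive_iff less_top)
  moreover have "(\<integral>\<^sup>+x. ennreal (norm (f x) powr enn2real q) \<partial>M) = (\<integral>\<^sup>+x. 0 \<partial>M)"
    by (rule nn_integral_cong_AE) (use 0 in \<open>eventually_elim, simp\<close>)
  ultimately show ?thesis using False by (simp add: lp_norm_def epowr_def)
qed

text \<open>
  A uniform bound of $f$ by its own $L^2$ norm is self-improving: the $L^2$ norm is dominated by
  an interpolation between the uniform norm and the $L^p$ norm, and the power of the
  uniform norm can be cancelled because it is finite and, unless $f$ vanishes almost everywhere, positive. The real number $s = (t \|f\|_2^2)^{1/2}$ plays
  the role of the uniform norm.
\<close>

lemma lp_norm_interpolation: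
  fixes f :: "'b \<Rightarrow> complex"
  assumes f: "integrable M f" and S: "l2sq M f < \<infinity>"
    and t: "0 \<le> t" and bound: "AE x in M. (ennreal (norm (f x)))\<^sup>2 \<le> ennreal t * l2sq M f"
    and p: "1 < p" "p \<le> 2" and q: "p \<le> q"
  shows "lp_norm q M f \<le> epowr (ennreal t) (enn2real (1 / p) - enn2real (1 / q)) * lp_norm p M f"
proof -
  have [measurable]: "f \<in> borel_measurable M" using f by simp
  have q0: "0 < q" using p(1) q by (metis order.strict_trans2 order.strict_trans zero_less_one)
  have ptop: "p \<noteq> \<infinity>" using p(2) by (auto simp: top_unique)
  define r where "r = enn2real p"
  have pr: "p = ennreal r" using ptop by (simp add: r_def less_top)
  have r: "1 < r" "r \<le> 2" using p pr by (auto simp: ennreal_le_iff2 ennreal_less_iff simp flip: ennreal_1 ennreal_numeral)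
  obtain S' where S': "l2sq M f = ennreal S'" "0 \<le> S'" using S by (cases "l2sq M f") auto
  define s where "s = sqrt (t * S')"
  have s: "0 \<le> s" "s\<^sup>2 = t * S'" using t S' by (auto simp: s_def)
  have le_s: "AE x in M. norm (f x) \<le> s"
    using bound
  proof eventually_elim
    case (elim x)
    then have "(norm (f x))\<^sup>2 \<le> t * S'"
      using t S' by (simp add: ennreal_power ennreal_mult[symmetric])
    then show ?case unfolding s_def by (rule real_le_rsqrt)
  qed
  show ?thesis
  proof (cases "s = 0")
    case True
    then have "AE x in M. f x = 0" using le_s by simp
    then show ?thesis using q0 lp_norm_AE_zero[of f M q] by simp
  next
    case False
    then have s0: "s > 0" using s by simp
    define A where "A b = (\<integral>\<^sup>+x. ennreal (norm (f x) powr b) \<partial>M)" for b :: real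
    have A_le: "A c \<le> ennreal (s powr (c - b)) * A b" if "0 < b" "b \<le> c" for b c
      unfolding A_def by (rule nn_integral_powr_le[OF _ le_s that]) measurable
    have "A 1 < \<infinity>" using f by (simp add: A_def integrable_iff_bounded)
    then have "ennreal (s powr (r - 1)) * A 1 < \<infinity>" by (simp add: ennreal_mult_less_top)
    then have "A r < \<infinity>" using A_le[of 1 r] r by (auto intro: order.strict_trans1)
    then obtain a where a: "A r = ennreal a" "0 \<le> a" by (cases "A r") auto
    have "l2sq M f = A 2"
      unfolding l2sq_def A_def by (intro nn_integral_cong) (simp add: ennreal_power)
    then have "ennreal S' \<le> ennreal (s powr (2 - r)) * ennreal a"
      using A_le[of r 2] r S' a by simp
    then have "S' \<le> s powr (2 - r) * a"
      using a by (simp add: ennreal_mult[symmetric])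
    \<comment> \<open>Self-improvement: the factor \<open>s powr (2 - r)\<close> is common to both sides and cancels.\<close>
    then have "s powr 2 \<le> s powr (2 - r) * (t * a)"
      using s t s0 mult_left_mono[of S' "s powr (2 - r) * a" t] by (simp add: mult_ac)
    moreover have "s powr 2 = s powr (2 - r) * s powr r" by (simp add: powr_add[symmetric])
    ultimately have sr: "s powr r \<le> t * a" using s0 by simp
    then have ta: "0 < t * a" using s0 by (smt (verit) powr_gt_zero)
    then have t0: "0 < t" and a0: "0 < a" using t a by (auto simp: zero_less_mult_iff)
    have ss: "s \<le> (t * a) powr (1 / r)"
    proof -
      have "s = (s powr r) powr (1 / r)" using s0 r by (simp add: powr_powr)
      also have "\<dots> \<le> (t * a) powr (1 / r)" using sr r by (intro powr_mono2) auto
      finally show ?thesis .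
    qed
    have ep: "epowr (ennreal t) e = ennreal (t powr e)" for e
      using t0 by (simp add: epowr_def)
    have lp: "lp_norm p M f = ennreal (a powr (1 / r))"
      using ptop a r by (simp add: lp_norm_def epowr_def r_def[symmetric] A_def[symmetric])
    have ip: "enn2real (1 / p) = 1 / r"
      using r by (simp add: pr divide_ennreal flip: ennreal_1)
    show ?thesis
    proof (cases "q = \<infinity>")
      case True
      have "AE x in M. ennreal (norm (f x)) \<le> ennreal s"
        using le_s by eventually_elim (rule ennreal_leI)
      then have "lp_norm q M f \<le> ennreal s"
        using True by (auto simp: lp_norm_def intro!: esssup_I)
      also have "\<dots> \<le> ennreal (t powr (1 / r) * a powr (1 / r))"
        using ss t0 a0 by (intro ennreal_leI) (simp add: powr_mult)
      also have "\<dots> = epowr (ennreal t) (enn2real (1 / p) - enn2real (1 / q)) * lp_norm p M f"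
        by (simp add: ip ep lp True ennreal_mult)
      finally show ?thesis .
    next
      case False
      define Q where "Q = enn2real q"
      have qQ: "q = ennreal Q" using False by (simp add: Q_def less_top)
      have Q: "r \<le> Q" using q pr qQ r by (auto simp: ennreal_le_iff2)
      have iq: "enn2real (1 / q) = 1 / Q"
        using r Q by (simp add: qQ divide_ennreal flip: ennreal_1)
      have "A Q \<le> ennreal (s powr (Q - r) * a)"
        using A_le[of r Q] Q r a by (simp add: ennreal_mult)
      then have AQ: "enn2real (A Q) \<le> s powr (Q - r) * a" and AQfin: "A Q \<noteq> \<infinity>"
        using a by (auto simp: enn2real_leI top_unique)
      have "s powr (Q - r) * a \<le> ((t * a) powr (1 / r)) powr (Q - r) * a"
        using ss Q s a by (intro mult_right_mono powr_mono2) auto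
      also have "\<dots> = t powr ((Q - r) / r) * a powr (Q / r)"
      proof -
        have "a powr ((Q - r) / r) * a = a powr ((Q - r) / r + 1)"
          using a0 by (simp add: powr_add)
        also have "(Q - r) / r + 1 = Q / r" using r by (simp add: field_simps)
        finally show ?thesis using t0 a0 by (simp add: powr_powr powr_mult)
      qed
      finally have "enn2real (A Q) \<le> t powr ((Q - r) / r) * a powr (Q / r)"
        using AQ by simp
      then have "enn2real (A Q) powr (1 / Q) \<le> (t powr ((Q - r) / r) * a powr (Q / r)) powr (1 / Q)"
        using Q r by (intro powr_mono2) auto
      also have "\<dots> = t powr (1 / r - 1 / Q) * a powr (1 / r)"
        using Q r t0 a0 by (simp add: powr_mult powr_powr) (simp add: field_simps)
      finally have "lp_norm q M f \<le> ennreal (t powr (1 / r - 1 / Q) * a powr (1 / r))"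
        using False AQfin Q r by (simp add: lp_norm_def epowr_def Q_def[symmetric] A_def[symmetric] ennreal_leI)
      then show ?thesis by (simp add: ip iq ep lp ennreal_mult)
    qed
  qed
qed

theorem theorem5p1:
  fixes \<mu> :: "'a::{topological_group_add,t2_space} measure"
    and p q :: ennreal
  assumes "locally_compact_space (euclidean :: 'a topology)"
    and "separable_space (euclidean :: 'a topology)"
    and "haar_measure \<mu>"
    and "unimodular \<mu>"
    and "1 < q"
    and "1 < p" and "p \<le> min 2 q"
  shows "\<exists>C::real. C > 0 \<and>
    (\<forall>f P. integrable \<mu> f \<longrightarrow>
       is_orth_projector \<mu> (supp_R \<mu> f) P \<longrightarrow>
       vn_trace \<mu> P < \<infinity> \<longrightarrow>
       lp_norm q \<mu> f \<le>
         ennreal C * epowr (vn_trace \<mu> P) (enn2real (1 / p) - enn2real (1 / q)) * lp_norm p \<mu> f)"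
proof (intro exI[of _ 1] conjI allI impI)
  interpret separable_unimodular_group \<mu>
    by standard (rule assms)+
  fix f :: "'a \<Rightarrow> complex" and P
  assume f: "integrable \<mu> f" and P: "is_orth_projector \<mu> (supp_R \<mu> f) P" and tr: "vn_trace \<mu> P < \<infinity>"
  obtain t where t: "vn_trace \<mu> P = ennreal t" "0 \<le> t" using tr by (cases "vn_trace \<mu> P") auto
  show "lp_norm q \<mu> f \<le>
         ennreal 1 * epowr (vn_trace \<mu> P) (enn2real (1 / p) - enn2real (1 / q)) * lp_norm p \<mu> f"
    using lp_norm_interpolation[OF f finite_trace_bounds(1)[OF f P tr] t(2), of p q]
      finite_trace_bounds(2)[OF f P tr] assms(6,7) by (simp add: t)
qed simp

end
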